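(* Let $q$ be a nonzero complex number with $|q|<1$. Then \begin{align*} \overline{\psi}_0(q)&=2-2q\,g(-q,q^8)-\frac{J_{1,2}\,\overline{J}_{3,8}}{J_2},\\ \overline{\psi}_1(q)&=2q^2g(-q^3,q^8)+\frac{J_{1,2}\,\overline{J}_{1,8}}{J_2}. \end{align*}
   Context: Notation: $(x;q)_n:=\prod_{i=0}^{n-1}(1-q^ix)$, $(x;q)_\infty:=\prod_{i\ge0}(1-q^ix)$. Theta functions: $j(x;q):=(x;q)_\infty(q/x;q)_\infty(q;q)_\infty=\sum_{n\in\mathbb{Z}}(-1)^nq^{\binom n2}x^n$; for integers $a,m$ with $m>0$, $J_{a,m}:=j(q^a;q^m)$, $\overline{J}_{a,m}:=j(-q^a;q^m)$, $J_m:=J_{m,3m}=\prod_{i\ge1}(1-q^{mi})$. The universal mock theta function is $$g(x,q):=x^{-1}\Big(-1+\sum_{n=0}^{\infty}\frac{q^{n^2}}{(x;q)_{n+1}(q/x;q)_n}\Big).$$ The functions $\overline{\psi}_0,\overline{\psi}_1$ are $$\overline{\psi}_0(q):=\sum_{n=0}^{\infty}\frac{q^{2n^2}}{(-q;q)_{2n}},\qquad \overline{\psi}_1(q):=\sum_{n=0}^{\infty}\frac{q^{2n^2+2n}}{(-q;q)_{2n+1}}.$$ *)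

theory Defs
  imports "HOL-Analysis.Analysis"
begin

definition qpoch :: "complex \<Rightarrow> complex \<Rightarrow> nat \<Rightarrow> complex" where
  "qpoch x q n = (\<Prod>i<n. 1 - q ^ i * x)"

definition qpoch_inf :: "complex \<Rightarrow> complex \<Rightarrow> complex" where
  "qpoch_inf x q = prodinf (\<lambda>i. 1 - q ^ i * x)"

definition theta_j :: "complex \<Rightarrow> complex \<Rightarrow> complex" where
  "theta_j x q = qpoch_inf x q * qpoch_inf (q / x) q * qpoch_inf q q"

text \<open>The nome \<open>q\<close>, implicit in \<open>J\<^bsub>a,m\<^esub>\<close>, \<open>Jbar\<^bsub>a,m\<^esub>\<close> and \<open>J\<^sub>m\<close>, is the first argument below.
  The indices are integers with \<open>m > 0\<close>.\<close>

definition theta_J :: "complex \<Rightarrow> int \<Rightarrow> int \<Rightarrow> complex" where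
  "theta_J q a m = theta_j (q powi a) (q powi m)"

definition theta_Jbar :: "complex \<Rightarrow> int \<Rightarrow> int \<Rightarrow> complex" where
  "theta_Jbar q a m = theta_j (- (q powi a)) (q powi m)"

definition theta_J1 :: "complex \<Rightarrow> int \<Rightarrow> complex" where
  "theta_J1 q m = theta_J q m (3 * m)"

definition mock_g :: "complex \<Rightarrow> complex \<Rightarrow> complex" where
  "mock_g x q =
     inverse x * (- 1 + (\<Sum>n. q ^ (n\<^sup>2) / (qpoch x q (n + 1) * qpoch (q / x) q n)))"

definition psibar0 :: "complex \<Rightarrow> complex" where
  "psibar0 q = (\<Sum>n. q ^ (2 * n\<^sup>2) / qpoch (- q) q (2 * n))"

definition psibar1 :: "complex \<Rightarrow> complex" where
  "psibar1 q = (\<Sum>n. q ^ (2 * n\<^sup>2 + 2 * n) / qpoch (- q) q (2 * n + 1))"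

end

(* With p^2 = q, psibar0(q) and p psibar1(q) are the even and odd parts of Ramanujan's third order
   mock theta function phi(p) = sum p^(n^2) / (-p^2;p^2)_n = (1 - i) A(i;p), where
   A(x;q) = 1 + x g(x,q) is the Eulerian series in the definition of g. A telescoping sum gives
   A(qx;q) = 1 - q x^2 - q x^3 A(x;q). Hence

     A(x;q) - A(-q x^2;q^4) / x + A(-q / x^2;q^4) - 1 + 1 / x,

   multiplied by j(x;q) j(-q x^2;q^4) j(-q / x^2;q^4), is holomorphic on the punctured plane and
   invariant under x -> q^2 x, so it is constant by the maximum principle; its value at x = 1 is
   given by Cauchy's sum for 1 / (q;q)_inf. Taking x = i in base p and then x = p in base p^4
   expresses phi(p) through A(-p^2;p^16), A(-p^6;p^16) and theta products, and the latter
   combine by the dissection j(x;q) = j(-q x^2;q^4) - x j(-q^3 x^2;q^4). *)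

theory Submission
  imports Defs "HOL-Complex_Analysis.Complex_Analysis"
begin

subsection \<open>Infinite products and theta functions\<close>

text \<open>The three series are matched by their multipliers. Up to elementary terms, the
  recurrence multiplies A(x;q) by -q x^3. Hence under x -> q^2 x each of A(x;q), A(-q x^2;q^4) / x
  and A(-q / x^2;q^4) acquires the same factor q^5 x^6: the first by two steps in base q, the second
  by one step in base q^4, the third by one such step backwards. The terms -1 + 1/x absorb the
  elementary parts, and the product of the three theta functions acquires the inverse factor. The
  poles of A lie at zeros of the accompanying theta function, so the periodicity argument is carried
  by \<open>mock_K\<close>, and A returns only at points where no theta function vanishes. The
  points serve elimination: at x = i both -p x^2 and -p / x^2 equal p, so the two remaining series
  merge into A(p;p^4), which reappears at x = p in base p^4. As theta functions are defined by
  products, their dissection, which on the series side is a separation by parity, is obtained from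
  the same periodicity principle.\<close>

lemma summable_norm_q_powers:
  fixes q x :: complex
  assumes "norm q < 1"
  shows "summable (\<lambda>i. norm (q ^ i * x))"
  using assms by (auto simp: norm_mult norm_power intro!: summable_mult2 summable_geometric)

lemma convergent_prod_qpoch:
  fixes q x :: complex
  assumes "norm q < 1"
  shows "convergent_prod (\<lambda>i. 1 - q ^ i * x)"
proof -
  have "abs_convergent_prod (\<lambda>i. 1 - q ^ i * x)"
    using summable_norm_q_powers[OF assms, of x] by (simp add: abs_convergent_prod_conv_summable)
  then show ?thesis
    by (rule abs_convergent_prod_imp_convergent_prod)
qed

lemma qpoch_tendsto:
  assumes "norm q < 1"
  shows "(\<lambda>n. qpoch x q n) \<longlonglongrightarrow> qpoch_inf x q"
  using convergent_prod_LIMSEQ[OF convergent_prod_qpoch[OF assms, of x]]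
  unfolding qpoch_def qpoch_inf_def
  by (subst (asm) LIMSEQ_lessThan_iff_atMost[symmetric])

lemma qpoch_inf_split:
  assumes "norm q < 1"
  shows "qpoch_inf x q = qpoch x q n * qpoch_inf (q ^ n * x) q"
proof -
  have "(\<lambda>i. 1 - q ^ i * x) has_prod ((\<Prod>k<n. 1 - q ^ k * x) * (\<Prod>k. 1 - q ^ (k + n) * x))"
    by (rule has_prod_ignore_initial_segment'[OF convergent_prod_qpoch[OF assms]])
  then show ?thesis
    unfolding qpoch_def qpoch_inf_def by (simp add: has_prod_iff power_add mult.assoc)
qed

lemma qpoch_inf_rec:
  assumes "norm q < 1"
  shows "qpoch_inf x q = (1 - x) * qpoch_inf (q * x) q"
  using qpoch_inf_split[OF assms, of x 1] by (simp add: qpoch_def)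

lemma qpoch_inf_one: "norm q < 1 \<Longrightarrow> qpoch_inf 1 q = 0"
  using qpoch_inf_rec[of q 1] by simp

lemma qpoch_inf_nonzero:
  assumes "norm q < 1" and "\<And>i. q ^ i * x \<noteq> 1"
  shows "qpoch_inf x q \<noteq> 0"
  unfolding qpoch_inf_def
proof (rule prodinf_nonzero[OF convergent_prod_qpoch[OF assms(1)]])
  show "1 - q ^ i * x \<noteq> 0" for i
    using assms(2)[of i] by auto
qed

lemma qpoch_inf_nonzero_norm:
  assumes "norm q < 1" and "norm x < 1"
  shows "qpoch_inf x q \<noteq> 0"
proof (rule qpoch_inf_nonzero[OF assms(1)])
  show "q ^ i * x \<noteq> 1" for i
  proof
    assume "q ^ i * x = 1"
    then have "norm q ^ i * norm x = 1"
      by (metis norm_mult norm_one norm_power)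
    moreover have "norm q ^ i * norm x \<le> 1 * norm x"
      using assms by (intro mult_right_mono power_le_one) auto
    ultimately show False
      using assms by simp
  qed
qed

text \<open>By 1 + t \<le> exp t and the geometric series. The bound does not depend on n, so it
  passes to the infinite product and later dominates the series for \<open>mock_K\<close>.\<close>

lemma norm_qpoch_le:
  assumes "norm q < 1"
  shows "norm (qpoch x q n) \<le> exp (norm x / (1 - norm q))"
proof -
  have "norm (qpoch x q n) \<le> (\<Prod>i<n. 1 + norm (q ^ i * x))"
    unfolding qpoch_def prod_norm[symmetric]
    by (intro prod_mono) (auto intro: order.trans[OF norm_triangle_ineq4])
  also have "\<dots> \<le> exp (\<Sum>i<n. norm (q ^ i * x))"
    by (rule prod_le_exp_sum) simp
  also have "(\<Sum>i<n. norm (q ^ i * x)) \<le> (\<Sum>i. norm (q ^ i * x))"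
    by (rule sum_le_suminf[OF summable_norm_q_powers[OF assms]]) auto
  also have "\<dots> = norm x / (1 - norm q)"
    using assms suminf_mult2[OF summable_geometric[of "norm q"], of "norm x"]
    by (simp add: norm_mult norm_power suminf_geometric)
  finally show ?thesis
    by simp
qed

lemma norm_qpoch_inf_le:
  assumes "norm q < 1"
  shows "norm (qpoch_inf x q) \<le> exp (norm x / (1 - norm q))"
  by (rule Lim_bounded[OF tendsto_norm[OF qpoch_tendsto[OF assms]]])
     (use norm_qpoch_le[OF assms] in auto)

lemma holomorphic_qpoch_inf_UNIV:
  assumes "norm q < 1"
  shows "(\<lambda>x. qpoch_inf x q) holomorphic_on UNIV"
proof (rule holomorphic_uniform_sequence)
  show "(\<lambda>x. qpoch x q n) holomorphic_on UNIV" for n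
    unfolding qpoch_def by (intro holomorphic_intros)
  fix z :: complex
  let ?B = "cball z 1"
  define M where "M = norm z + 1"
  have "uniformly_convergent_on ?B (\<lambda>n x. \<Prod>i<n. 1 - q ^ i * x)"
  proof (rule uniformly_convergent_on_prod')
    show "uniformly_convergent_on ?B (\<lambda>N x. \<Sum>n<N. norm (1 - q ^ n * x - 1))"
    proof (rule Weierstrass_m_test')
      show "norm (norm (1 - q ^ n * x - 1)) \<le> norm (q ^ n * of_real M)" if "x \<in> ?B" for n x
      proof -
        have "norm x \<le> M" "0 \<le> M"
          using that norm_triangle_ineq2[of x z] by (auto simp: M_def dist_norm norm_minus_commute)
        then show ?thesis
          by (simp add: norm_mult norm_power mult_left_mono)
      qed
      show "summable (\<lambda>n. norm (q ^ n * of_real M))"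
        by (rule summable_norm_q_powers[OF assms])
    qed
  qed (auto intro!: continuous_intros)
  then obtain l where l: "uniform_limit ?B (\<lambda>n x. qpoch x q n) l sequentially"
    unfolding qpoch_def uniformly_convergent_on_def by auto
  have "l x = qpoch_inf x q" if "x \<in> ?B" for x
    using tendsto_uniform_limitI[OF l that] qpoch_tendsto[OF assms] LIMSEQ_unique by blast
  then have "uniform_limit ?B (\<lambda>n x. qpoch x q n) (\<lambda>x. qpoch_inf x q) sequentially"
    using l by (metis (no_types, lifting) uniform_limit_cong')
  then show "\<exists>d>0. cball z d \<subseteq> UNIV \<and> uniform_limit (cball z d) (\<lambda>n x. qpoch x q n) (\<lambda>x. qpoch_inf x q) sequentially"
    by (intro exI[of _ 1]) auto
qed auto

lemma holomorphic_qpoch_inf [holomorphic_intros]: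
  assumes "norm q < 1" and "f holomorphic_on S"
  shows "(\<lambda>x. qpoch_inf (f x) q) holomorphic_on S"
  using holomorphic_on_compose_gen[OF assms(2) holomorphic_qpoch_inf_UNIV[OF assms(1)]]
  by (simp add: o_def)

section \<open>Infinite products under a change of base\<close>

lemma qpoch_inf_dissect:
  assumes "norm q < 1" and "m > 0"
  shows "qpoch_inf x q = (\<Prod>k<m. qpoch_inf (q ^ k * x) (q ^ m))"
proof -
  have qm: "norm (q ^ m) < 1"
    using assms by (simp add: norm_power power_less_one_iff)
  have "qpoch x q (n * m) = (\<Prod>k<m. qpoch (q ^ k * x) (q ^ m) n)" for n
  proof -
    \<comment> \<open>The factors are cut into n consecutive blocks of length m; exchanging the two
      products collects the exponents by their residue k modulo m.\<close>
    have "qpoch x q (n * m) = (\<Prod>i<n. \<Prod>k\<in>{i*m..<i*m+m}. 1 - q ^ k * x)"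
      unfolding qpoch_def by (rule prod.nat_group[symmetric])
    also have "\<dots> = (\<Prod>i<n. \<Prod>k<m. 1 - (q ^ m) ^ i * (q ^ k * x))"
    proof (rule prod.cong[OF refl])
      fix i
      have "(\<Prod>k\<in>{0+i*m..<m+i*m}. 1 - q ^ k * x) = (\<Prod>k\<in>{0..<m}. 1 - q ^ (k+i*m) * x)"
        by (rule prod.shift_bounds_nat_ivl)
      then show "(\<Prod>k\<in>{i*m..<i*m+m}. 1 - q ^ k * x) = (\<Prod>k<m. 1 - (q ^ m) ^ i * (q ^ k * x))"
        by (simp add: lessThan_atLeast0 power_add power_mult[symmetric] mult_ac add_ac)
    qed
    also have "\<dots> = (\<Prod>k<m. qpoch (q ^ k * x) (q ^ m) n)"
      unfolding qpoch_def by (rule prod.swap)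
    finally show ?thesis .
  qed
  moreover have "(\<lambda>n. \<Prod>k<m. qpoch (q ^ k * x) (q ^ m) n)
      \<longlonglongrightarrow> (\<Prod>k<m. qpoch_inf (q ^ k * x) (q ^ m))"
    by (intro tendsto_prod qpoch_tendsto qm)
  moreover have "(\<lambda>n. qpoch x q (n * m)) \<longlonglongrightarrow> qpoch_inf x q"
  proof -
    have "filterlim (\<lambda>n. n * m) at_top sequentially"
      using assms(2) by (intro filterlim_subseq strict_monoI) auto
    from filterlim_compose[OF qpoch_tendsto[OF assms(1)] this] show ?thesis .
  qed
  ultimately show ?thesis
    using LIMSEQ_unique by auto
qed

lemma qpoch_inf_dissect2:
  assumes "norm q < 1"
  shows "qpoch_inf x q = qpoch_inf x (q\<^sup>2) * qpoch_inf (q * x) (q\<^sup>2)"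
  using qpoch_inf_dissect[OF assms, of 2 x] by (simp add: numeral_2_eq_2)

lemma qpoch_inf_mult_minus:
  assumes "norm q < 1"
  shows "qpoch_inf x q * qpoch_inf (- x) q = qpoch_inf (x\<^sup>2) (q\<^sup>2)"
proof (rule LIMSEQ_unique)
  have "qpoch x q n * qpoch (- x) q n = qpoch (x\<^sup>2) (q\<^sup>2) n" for n
    unfolding qpoch_def prod.distrib[symmetric]
    by (rule prod.cong) (simp_all add: algebra_simps power2_eq_square power_mult_distrib)
  then show "(\<lambda>n. qpoch (x\<^sup>2) (q\<^sup>2) n) \<longlonglongrightarrow> qpoch_inf x q * qpoch_inf (- x) q"
    using tendsto_mult[OF qpoch_tendsto[OF assms, of x] qpoch_tendsto[OF assms, of "- x"]] by simp
  show "(\<lambda>n. qpoch (x\<^sup>2) (q\<^sup>2) n) \<longlonglongrightarrow> qpoch_inf (x\<^sup>2) (q\<^sup>2)"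
    using assms by (intro qpoch_tendsto) (simp add: norm_power power_less_one_iff)
qed

text \<open>The shift removes the factor 1 - x from the first infinite product and adds 1 - 1/x =
  -(1 - x)/x to the second.\<close>

lemma theta_j_shift:
  assumes "norm q < 1" and "q \<noteq> 0" and "x \<noteq> 0"
  shows "theta_j (q * x) q = - theta_j x q / x"
proof (cases "x = 1")
  case True
  then show ?thesis
    using assms by (simp add: theta_j_def qpoch_inf_one)
next
  case False
  have "theta_j (q * x) q = qpoch_inf (q * x) q * ((1 - 1 / x) * qpoch_inf (q / x) q) * qpoch_inf q q"
    using qpoch_inf_rec[OF assms(1), of "1 / x"] assms by (simp add: theta_j_def)
  also have "\<dots> = - ((1 - x) * qpoch_inf (q * x) q * qpoch_inf (q / x) q * qpoch_inf q q) / x"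
    using assms by (simp add: field_simps)
  also have "\<dots> = - theta_j x q / x"
    using qpoch_inf_rec[OF assms(1), of x] by (simp add: theta_j_def)
  finally show ?thesis .
qed

lemma theta_j_shift_back:
  assumes "norm q < 1" and "q \<noteq> 0" and "x \<noteq> 0"
  shows "theta_j (x / q) q = - (x / q) * theta_j x q"
  using theta_j_shift[OF assms(1,2), of "x / q"] assms by (simp add: field_simps)

lemma theta_j_reflect:
  assumes "q \<noteq> 0" and "x \<noteq> 0"
  shows "theta_j (q / x) q = theta_j x q"
  using assms by (simp add: theta_j_def)

lemma holomorphic_theta_j [holomorphic_intros]:
  assumes "norm q < 1" and "f holomorphic_on S" and "\<And>x. x \<in> S \<Longrightarrow> f x \<noteq> 0"
  shows "(\<lambda>x. theta_j (f x) q) holomorphic_on S"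
  unfolding theta_j_def using assms by (intro holomorphic_intros) auto

section \<open>Holomorphic functions on an annulus that are invariant under z -> qz\<close>

lemma connected_annulus:
  fixes r R :: real
  assumes "0 < r" and "0 < R"
  shows "connected {z::complex. r < norm z \<and> norm z < R}"
proof -
  \<comment> \<open>The annulus is the image of a vertical strip under \<open>exp\<close>, and the
    strip is convex.\<close>
  let ?S = "{w::complex. ln r < Re w} \<inter> {w. Re w < ln R}"
  have "connected (exp ` ?S)"
    by (intro connected_continuous_image continuous_intros convex_connected convex_Int
        convex_halfspace_Re_gt convex_halfspace_Re_lt)
  also have "exp ` ?S = {z. r < norm z \<and> norm z < R}"
  proof safe
    fix z :: complex
    assume z: "r < norm z" "norm z < R"
    then have "z \<noteq> 0"
      using assms by auto
    then show "z \<in> exp ` ?S"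
      using z assms by (intro image_eqI[of _ _ "Ln z"]) auto
  next
    fix w :: complex
    assume "ln r < Re w" "Re w < ln R"
    then show "r < norm (exp w)" "norm (exp w) < R"
      using assms by (metis exp_less_mono exp_ln norm_exp_eq_Re)+
  qed
  finally show ?thesis .
qed

text \<open>Liouville's theorem for the punctured plane modulo powers of q: |h| attains its maximum
  on a compact set of representatives, and this is a maximum over the whole open annulus.
  Periodicity is asked exactly where z and qz both lie in the annulus.\<close>

lemma holomorphic_q_periodic_constant:
  fixes q :: complex
  assumes q: "q \<noteq> 0" "norm q < 1"
    and hol: "h holomorphic_on {z. norm q < norm z \<and> norm z < 1 / norm q}"
    and per: "\<And>z. 1 < norm z \<Longrightarrow> norm z < 1 / norm q \<Longrightarrow> h (q * z) = h z"
  shows "h constant_on {z. norm q < norm z \<and> norm z < 1 / norm q}"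
proof -
  define S where "S = {z::complex. norm q < norm z \<and> norm z < 1 / norm q}"
  \<comment> \<open>The closed annulus r \<le> |z| \<le> 1/r has ratio of radii 1/|q|, so a single
    multiplication or division by q brings every other point of \<open>S\<close> into it.\<close>
  define r where "r = sqrt (norm q)"
  have r: "0 < r" "r < 1" "r * r = norm q"
    using q by (auto simp: r_def)
  have rq: "norm q < r" "1 / r < 1 / norm q"
    using r by (auto simp: mult_less_cancel_left1 simp flip: r(3) intro!: divide_strict_left_mono)
  define K where "K = cball (0::complex) (1 / r) - ball 0 r"
  have K: "K \<subseteq> S"
    using r rq by (auto simp: K_def S_def)
  have "compact K"
    unfolding K_def by (intro compact_diff) auto
  moreover have "1 \<in> K"
    using r by (auto simp: K_def)
  moreover have "continuous_on K (\<lambda>z. norm (h z))"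
    using hol K by (intro continuous_intros holomorphic_on_imp_continuous_on)
      (auto simp: S_def intro: holomorphic_on_subset)
  ultimately obtain \<xi> where \<xi>: "\<xi> \<in> K" "\<And>z. z \<in> K \<Longrightarrow> norm (h z) \<le> norm (h \<xi>)"
    using continuous_attains_sup[of K "\<lambda>z. norm (h z)"] by blast
  have "norm (h z) \<le> norm (h \<xi>)" if "z \<in> S" for z
  proof -
    consider "z \<in> K" | "norm z > 1 / r" | "norm z < r"
      unfolding K_def by fastforce
    then show ?thesis
    proof cases
      case 2
      have z: "norm z < 1 / norm q"
        using that by (simp add: S_def)
      have "1 < 1 / r"
        using r by simp
      then have "1 < norm z"
        using 2 by linarith
      moreover have "q * z \<in> K"
      proof -
        have "r * (r * norm z) > r * 1"
          using 2 r by (intro mult_strict_left_mono) (auto simp: field_simps)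
        moreover have "norm q * norm z < 1"
          using z q by (simp add: field_simps)
        ultimately show ?thesis
          using \<open>1 < 1 / r\<close> by (auto simp: K_def norm_mult mult.assoc simp flip: r(3))
      qed
      ultimately show ?thesis
        using per[of z] z \<xi>(2)[of "q * z"] by simp
    next
      case 3
      have z: "norm q < norm z"
        using that by (simp add: S_def)
      have 1: "1 < norm (z / q)" "norm (z / q) < 1 / r"
      proof -
        have "norm z * r < norm q"
          using 3 r mult_strict_right_mono[of "norm z" r r] by simp
        then show "1 < norm (z / q)" "norm (z / q) < 1 / r"
          using z q r(1) by (simp_all add: norm_divide pos_less_divide_eq)
      qed
      moreover have "z / q \<in> K"
        using 1 r by (auto simp: K_def)
      ultimately show ?thesis
        using per[of "z / q"] rq \<xi>(2)[of "z / q"] q by simp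
    qed (use \<xi> in auto)
  qed
  moreover have "open S"
    unfolding S_def by (intro open_Collect_conj open_Collect_less continuous_intros)
  moreover have "connected S"
    unfolding S_def using q by (intro connected_annulus) auto
  ultimately show ?thesis
    using maximum_modulus_principle[of h S S \<xi>] hol \<xi>(1) K by (auto simp: S_def)
qed

subsection \<open>The universal mock theta function\<close>

definition mock_A :: "complex \<Rightarrow> complex \<Rightarrow> complex" where
  "mock_A x q = (\<Sum>n. q ^ (n\<^sup>2) / (qpoch x q (n + 1) * qpoch (q / x) q n))"

text \<open>\<open>K = j(x;q) A(x;q)\<close>, multiplied out termwise so that it makes sense, and is holomorphic,
  also at the poles \<open>x = q\<^sup>k\<close> of \<open>A\<close>.\<close>

definition mock_K :: "complex \<Rightarrow> complex \<Rightarrow> complex" where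
  "mock_K x q = qpoch_inf q q *
     (\<Sum>n. q ^ (n\<^sup>2) * (qpoch_inf (q ^ (n + 1) * x) q * qpoch_inf (q ^ (n + 1) / x) q))"

section \<open>Convergence and holomorphy of \<open>mock_K\<close>\<close>

lemma norm_q_power_le:
  fixes q :: complex
  assumes "norm q < 1" and "m \<le> n"
  shows "norm (q ^ n) \<le> norm q ^ m"
  using assms by (simp add: norm_power power_decreasing)

lemma norm_qpoch_inf_power_le:
  assumes "norm q < 1"
  shows "norm (qpoch_inf (q ^ n * x) q) \<le> exp (norm x / (1 - norm q))"
proof -
  have "norm (q ^ n * x) \<le> norm x"
    using norm_q_power_le[OF assms, of 0 n] by (auto simp: norm_mult intro: mult_left_le_one_le)
  then have "exp (norm (q ^ n * x) / (1 - norm q)) \<le> exp (norm x / (1 - norm q))"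
    using assms by (simp add: divide_right_mono)
  then show ?thesis
    using norm_qpoch_inf_le[OF assms, of "q ^ n * x"] by linarith
qed

text \<open>Convergence comes from q^(n^2) alone. The exponents k and l are free, so that the bound
  also covers the telescoping primitive, whose two products start at different powers; bounding both
  |x| and |1/x| by M makes it uniform away from 0 and infinity.\<close>

lemma norm_mock_K_term_le:
  assumes "norm q < 1" and "norm x \<le> M" and "norm (1 / x) \<le> M"
  shows "norm (q ^ (n\<^sup>2) * (qpoch_inf (q ^ k * x) q * qpoch_inf (q ^ l / x) q))
           \<le> norm q ^ n * (exp (M / (1 - norm q)))\<^sup>2"
proof -
  have "norm (qpoch_inf (q ^ k * x) q) \<le> exp (M / (1 - norm q))"
    using norm_qpoch_inf_power_le[OF assms(1), of k x] assms
    by (elim order.trans) (simp add: divide_right_mono)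
  moreover have "norm (qpoch_inf (q ^ l * (1 / x)) q) \<le> exp (M / (1 - norm q))"
    using norm_qpoch_inf_power_le[OF assms(1), of l "1 / x"] assms(1,3)
    by (elim order.trans) (simp add: divide_right_mono)
  moreover have "norm (q ^ (n\<^sup>2)) \<le> norm q ^ n"
    using assms(1) by (intro norm_q_power_le) (auto simp: power2_eq_square)
  ultimately show ?thesis
    by (auto simp: norm_mult power2_eq_square intro!: mult_mono)
qed

lemma summable_mock_K:
  assumes "norm q < 1"
  shows "summable (\<lambda>n. q ^ (n\<^sup>2) * (qpoch_inf (q ^ (n + 1) * x) q * qpoch_inf (q ^ (n + 1) / x) q))"
  using assms
  by (intro summable_comparison_test'[OF _ norm_mock_K_term_le[of q x "max (norm x) (norm (1 / x))"]]
      summable_mult2 summable_geometric) auto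

lemma holomorphic_mock_K_aux:
  assumes "norm q < 1"
  shows "(\<lambda>x. mock_K x q) holomorphic_on - {0}"
  unfolding mock_K_def
proof (intro holomorphic_intros)
  let ?t = "\<lambda>n x. q ^ (n\<^sup>2) * (qpoch_inf (q ^ (n + 1) * x) q * qpoch_inf (q ^ (n + 1) / x) q)"
  show "(\<lambda>x. \<Sum>n. ?t n x) holomorphic_on - {0}"
  proof (rule holomorphic_uniform_sequence)
    show "(\<lambda>x. \<Sum>n<N. ?t n x) holomorphic_on - {0}" for N
      using assms by (intro holomorphic_intros) auto
    fix z :: complex
    assume "z \<in> - {0}"
    then have d: "norm z / 2 > 0"
      by simp
    let ?B = "cball z (norm z / 2)"
    \<comment> \<open>On this disc |x| \<le> 2|z| and |1/x| \<le> 2/|z|; the sum dominates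
      both.\<close>
    define M where "M = 2 * norm z + 2 / norm z"
    have B: "x \<noteq> 0 \<and> norm x \<le> M \<and> norm (1 / x) \<le> M" if "x \<in> ?B" for x
    proof -
      have "norm (z - x) \<le> norm z / 2"
        using that by (simp add: dist_norm)
      then have "norm x \<le> 2 * norm z" "norm z / 2 \<le> norm x"
        using norm_triangle_ineq2[of x z] norm_triangle_ineq2[of z x] norm_ge_zero[of z]
        by (simp_all add: norm_minus_commute)
      moreover from this have "0 < norm x"
        using d by linarith
      with \<open>norm z / 2 \<le> norm x\<close> have "norm (1 / x) \<le> 2 / norm z"
        using d divide_left_mono[of "norm z / 2" "norm x" 1] by (simp add: norm_divide)
      moreover have "0 \<le> 2 / norm z" "0 \<le> norm z" "x \<noteq> 0"
        using d \<open>norm z / 2 \<le> norm x\<close> by auto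
      ultimately show ?thesis
        unfolding M_def by linarith
    qed
    have "uniform_limit ?B (\<lambda>N x. \<Sum>n<N. ?t n x) (\<lambda>x. \<Sum>n. ?t n x) sequentially"
    proof (rule Weierstrass_m_test)
      show "norm (?t n x) \<le> norm q ^ n * (exp (M / (1 - norm q)))\<^sup>2" if "x \<in> ?B" for n x
        using B[OF that] assms by (intro norm_mock_K_term_le) auto
      show "summable (\<lambda>n. norm q ^ n * (exp (M / (1 - norm q)))\<^sup>2)"
        using assms by (intro summable_mult2 summable_geometric) auto
    qed
    moreover have "?B \<subseteq> - {0}"
      using B by blast
    ultimately show "\<exists>d>0. cball z d \<subseteq> - {0} \<and>
        uniform_limit (cball z d) (\<lambda>N x. \<Sum>n<N. ?t n x) (\<lambda>x. \<Sum>n. ?t n x) sequentially"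
      using d by blast
  qed auto
qed

lemma holomorphic_mock_K [holomorphic_intros]:
  assumes "norm q < 1" and "f holomorphic_on S" and "\<And>x. x \<in> S \<Longrightarrow> f x \<noteq> 0"
  shows "(\<lambda>x. mock_K (f x) q) holomorphic_on S"
proof -
  have "f ` S \<subseteq> - {0}"
    using assms(3) by auto
  from holomorphic_on_compose_gen[OF assms(2) holomorphic_mock_K_aux[OF assms(1)] this]
  show ?thesis
    by (simp add: o_def)
qed

text \<open>Dividing a term of \<open>mock_K\<close> by the full products (x;q) and (q/x;q) leaves
  the reciprocals of their initial segments, of lengths n + 1 and n. A nonzero theta function keeps
  all these segments nonzero.\<close>

lemma sums_mock_A:
  assumes "norm q < 1" and "theta_j x q \<noteq> 0"
  shows "(\<lambda>n. q ^ (n\<^sup>2) / (qpoch x q (n + 1) * qpoch (q / x) q n)) sums (mock_K x q / theta_j x q)"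
proof -
  let ?P = "qpoch_inf x q * qpoch_inf (q / x) q"
  let ?t = "\<lambda>n. q ^ (n\<^sup>2) * (qpoch_inf (q ^ (n + 1) * x) q * qpoch_inf (q ^ (n + 1) / x) q)"
  have P: "?P \<noteq> 0"
    using assms(2) by (auto simp: theta_j_def)
  have t: "?t n / ?P = q ^ (n\<^sup>2) / (qpoch x q (n + 1) * qpoch (q / x) q n)" for n
    using qpoch_inf_split[OF assms(1), of x "n + 1"] qpoch_inf_split[OF assms(1), of "q / x" n] P
    by (auto simp: mult_ac)
  have "(\<lambda>n. ?t n / ?P) sums ((\<Sum>n. ?t n) / ?P)"
    by (intro sums_divide summable_sums summable_mock_K assms)
  moreover have "(\<Sum>n. ?t n) / ?P = mock_K x q / theta_j x q"
    using assms(2) by (simp add: mock_K_def theta_j_def)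
  ultimately show ?thesis
    unfolding t by simp
qed

lemma mock_K_eq:
  assumes "norm q < 1" and "theta_j x q \<noteq> 0"
  shows "mock_K x q = theta_j x q * mock_A x q"
proof -
  have "mock_A x q = mock_K x q / theta_j x q"
    unfolding mock_A_def by (rule sums_unique[OF sums_mock_A[OF assms], symmetric])
  then show ?thesis
    using assms(2) by simp
qed

text \<open>The summands of \<open>K(qx) - qx\<^sup>2 K(x)\<close> telescope, with the primitive \<open>T\<close> below.\<close>

lemma mock_K_shift:
  assumes q: "norm q < 1" "q \<noteq> 0" and x: "x \<noteq> 0"
  shows "mock_K (q * x) q = q * x\<^sup>2 * mock_K x q - (1 - q * x\<^sup>2) / x * theta_j x q"
proof -
  let ?t = "\<lambda>y n. q ^ (n\<^sup>2) * (qpoch_inf (q ^ (n + 1) * y) q * qpoch_inf (q ^ (n + 1) / y) q)"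
  define T where "T = (\<lambda>n. - (1 - q * x\<^sup>2) *
    (q ^ (n\<^sup>2) * (qpoch_inf (q ^ (n + 1) * x) q * qpoch_inf (q ^ n / x) q)))"
  have step: "?t (q * x) n - q * x\<^sup>2 * ?t x n = T (Suc n) - T n" for n
  proof -
    define a b Q where "a = qpoch_inf (q ^ (n + 2) * x) q" and "b = qpoch_inf (q ^ (n + 1) / x) q"
      and "Q = q ^ n"
    define y where "y = Q / x"
    have a': "qpoch_inf (q ^ (n + 1) * x) q = (1 - q * Q * x) * a"
      using qpoch_inf_rec[OF q(1), of "q ^ (n + 1) * x"] by (simp add: a_def Q_def mult_ac)
    have b': "qpoch_inf (q ^ n / x) q = (1 - y) * b"
      using qpoch_inf_rec[OF q(1), of "q ^ n / x"] by (simp add: b_def Q_def y_def mult_ac)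
    \<comment> \<open>Once q^(n^2) a b is pulled out, this is the telescoping. The cross term q Q^2
      of (1 - q Q x)(1 - y) is cancelled by the factor q Q^2 between q^(n^2) and
      q^((n+1)^2).\<close>
    have core: "(1 - y) - q * x\<^sup>2 * (1 - q * Q * x)
        = (1 - q * x\<^sup>2) * ((1 - q * Q * x) * (1 - y) - q * Q\<^sup>2)"
      using x by (simp add: y_def field_simps power2_eq_square)
    have e: "q ^ (n + 1) * (q * x) = q ^ (n + 2) * x" "q ^ (n + 1) / (q * x) = q ^ n / x"
      using q by (simp_all add: field_simps)
    have s: "q ^ ((Suc n)\<^sup>2) = q ^ (n\<^sup>2) * (q * Q\<^sup>2)"
      by (simp add: Q_def power2_eq_square power_add)
    have T1: "T (Suc n) = - (1 - q * x\<^sup>2) * (q ^ (n\<^sup>2) * (q * Q\<^sup>2) * (a * b))"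
      unfolding T_def s by (simp add: a_def b_def)
    have T0: "T n = - (1 - q * x\<^sup>2) * (q ^ (n\<^sup>2) * ((1 - q * Q * x) * a * ((1 - y) * b)))"
      unfolding T_def a' b' ..
    have l: "?t (q * x) n - q * x\<^sup>2 * ?t x n
        = q ^ (n\<^sup>2) * a * b * ((1 - y) - q * x\<^sup>2 * (1 - q * Q * x))"
      unfolding e a' b' b_def[symmetric] a_def[symmetric] by (simp add: algebra_simps)
    have r: "T (Suc n) - T n
        = q ^ (n\<^sup>2) * a * b * ((1 - q * x\<^sup>2) * ((1 - q * Q * x) * (1 - y) - q * Q\<^sup>2))"
      unfolding T1 T0 by (simp add: algebra_simps)
    show ?thesis
      by (simp only: l r core)
  qed
  have "T \<longlonglongrightarrow> - (1 - q * x\<^sup>2) * 0"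
    unfolding T_def
  proof (rule tendsto_mult_left, rule Lim_null_comparison[OF always_eventually[OF allI]])
    show "norm (q ^ (n\<^sup>2) * (qpoch_inf (q ^ (n + 1) * x) q * qpoch_inf (q ^ n / x) q))
        \<le> norm q ^ n * (exp (max (norm x) (norm (1 / x)) / (1 - norm q)))\<^sup>2" for n
      using q by (intro norm_mock_K_term_le) auto
    show "(\<lambda>n. norm q ^ n * (exp (max (norm x) (norm (1 / x)) / (1 - norm q)))\<^sup>2) \<longlonglongrightarrow> 0"
      using q by (intro tendsto_mult_left_zero LIMSEQ_power_zero) auto
  qed
  from telescope_sums[OF this] have "(\<Sum>n. T (Suc n) - T n) = - T 0"
    by (simp add: sums_iff)
  moreover have "(\<Sum>n. ?t (q * x) n - q * x\<^sup>2 * ?t x n)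
      = (\<Sum>n. ?t (q * x) n) - q * x\<^sup>2 * (\<Sum>n. ?t x n)"
    unfolding suminf_mult[OF summable_mock_K[OF q(1)], symmetric]
    by (rule suminf_diff[symmetric]) (intro summable_mock_K q summable_mult)+
  ultimately have "(\<Sum>n. ?t (q * x) n) - q * x\<^sup>2 * (\<Sum>n. ?t x n) = - T 0"
    unfolding step by simp
  also have "\<dots> = (1 - q * x\<^sup>2) * (qpoch_inf (q * x) q * qpoch_inf (1 / x) q)"
    by (simp add: T_def algebra_simps)
  finally have *: "(\<Sum>n. ?t (q * x) n)
      = q * x\<^sup>2 * (\<Sum>n. ?t x n) + (1 - q * x\<^sup>2) * (qpoch_inf (q * x) q * qpoch_inf (1 / x) q)"
    by (simp add: algebra_simps)
  \<comment> \<open>Together with (q;q), the boundary term -T 0 contains exactly the product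
    j(qx;q).\<close>
  have "qpoch_inf q q * (qpoch_inf (q * x) q * qpoch_inf (1 / x) q) = - theta_j x q / x"
    using theta_j_shift[OF q x] q by (simp add: theta_j_def mult_ac)
  then have **: "qpoch_inf q q * ((1 - q * x\<^sup>2) * (qpoch_inf (q * x) q * qpoch_inf (1 / x) q))
      = - ((1 - q * x\<^sup>2) / x * theta_j x q)"
    by (metis (no_types, lifting) minus_divide_left mult.left_commute mult_minus_left mult_minus_right times_divide_eq_left times_divide_eq_right)
  show ?thesis
    unfolding mock_K_def * distrib_left ** by (simp only: mult_ac diff_conv_add_uminus)
qed

text \<open>Contiguous values satisfy \<open>H\<^sub>k - H\<^bsub>k+1\<^esub> = q\<^bsup>k+1\<^esup> (H\<^bsub>k+2\<^esub> - H\<^bsub>k+1\<^esub>)\<close>; as \<open>H\<close> is bounded it is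
  constant, and only the first term of the sum survives as \<open>k \<rightarrow> \<infinity>\<close>.\<close>

lemma cauchy_durfee_sum:
  assumes "norm q < 1"
  shows "(\<Sum>n. q ^ (n\<^sup>2 + n * k) / (qpoch q q n * qpoch q q (n + k))) = 1 / qpoch_inf q q"
proof -
  define h where "h = (\<lambda>k n. q ^ (n\<^sup>2 + n * k) / (qpoch q q n * qpoch q q (n + k)))"
  define H where "H = (\<lambda>k. \<Sum>n. h k n)"
  have nz: "qpoch_inf q q \<noteq> 0"
    using assms by (rule qpoch_inf_nonzero_norm) fact
  have nzn: "qpoch q q n \<noteq> 0" for n
    using nz qpoch_inf_split[OF assms, of q n] by auto
  have lim: "(\<lambda>n. 1 / qpoch q q n) \<longlonglongrightarrow> 1 / qpoch_inf q q"
    by (intro tendsto_intros qpoch_tendsto assms nz)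
  then obtain B where B: "B > 0" "\<And>n. norm (1 / qpoch q q n) \<le> B"
    using convergent_imp_Bseq[unfolded convergent_def, OF exI[of _ "1 / qpoch_inf q q"], OF lim]
    unfolding Bseq_def by blast
  have hB: "norm (h k n) \<le> norm q ^ (n + n * k) * B\<^sup>2" for k n
  proof -
    define u v where "u = q ^ (n\<^sup>2 + n * k)"
      and "v = (1 / qpoch q q n) * (1 / qpoch q q (n + k))"
    have "norm u \<le> norm q ^ (n + n * k)"
      unfolding u_def using assms by (intro norm_q_power_le) (auto simp: power2_eq_square)
    moreover have "norm v \<le> B * B"
      unfolding v_def norm_mult using B by (intro mult_mono) auto
    moreover have "h k n = u * v"
      by (simp add: h_def u_def v_def)
    ultimately show ?thesis
      by (auto simp: norm_mult power2_eq_square intro!: mult_mono)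
  qed
  have hB0: "norm (h k n) \<le> norm q ^ n * B\<^sup>2" for k n
  proof -
    have "norm q ^ (n + n * k) \<le> norm q ^ n"
      using assms by (intro power_decreasing) auto
    then have "norm q ^ (n + n * k) * B\<^sup>2 \<le> norm q ^ n * B\<^sup>2"
      by (intro mult_right_mono) auto
    then show ?thesis
      using hB[of k n] by linarith
  qed
  have sumB: "summable (\<lambda>n. norm q ^ n * B\<^sup>2)"
    using assms by (intro summable_mult2 summable_geometric) auto
  have summ: "summable (h k)" for k
    by (rule summable_comparison_test'[OF sumB]) (rule hB0)
  have HB: "norm (H k) \<le> (\<Sum>n. norm q ^ n * B\<^sup>2)" for k
    unfolding H_def by (rule norm_suminf_le[OF hB0 sumB])
  have rec: "H k - H (k + 1) = q ^ (k + 1) * (H (k + 2) - H (k + 1))" for k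
  proof -
    \<comment> \<open>Over the common denominator, 1 - q^(k+1) q^n - q^n is split as (1 - q^n) -
      q^(k+1) q^n. The factor 1 - q^n in \<open>g\<close> kills the term n = 0 and cancels the last
      factor of (q;q)_n, so shifting n by one turns \<open>g\<close> into q^(k+1) times the summand
      for k + 2.\<close>
    define g where "g = (\<lambda>n. q ^ (n\<^sup>2 + n * k) * (1 - q ^ n) / (qpoch q q n * qpoch q q (n + k + 1)))"
    have qS: "qpoch q q (Suc n) = qpoch q q n * (1 - q ^ Suc n)" for n
      by (simp add: qpoch_def mult.commute)
    have nS: "1 - q ^ Suc n \<noteq> 0" for n
      using nzn[of "Suc n"] qS[of n] by auto
    have g: "h k n - h (k + 1) n = g n - q ^ (k + 1) * h (k + 1) n" for n
    proof -
      define u a b w v where "u = q ^ (n\<^sup>2 + n * k)" and "a = qpoch q q n"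
        and "b = qpoch q q (n + k)" and "w = q ^ n" and "v = q ^ (k + 1)"
      define D where "D = a * (b * (1 - v * w))"
      have vw: "q ^ Suc (n + k) = v * w"
        by (simp add: v_def w_def power_add mult_ac)
      have nz': "1 - v * w \<noteq> 0"
        using nS[of "n + k"] unfolding vw .
      have c: "qpoch q q (n + (k + 1)) = b * (1 - v * w)"
        using qS[of "n + k"] by (simp add: b_def flip: vw)
      have A1: "h k n = u * (1 - v * w) / D"
        using nz' by (simp add: h_def u_def a_def b_def D_def)
      have A2: "h (k + 1) n = u * w / D"
        unfolding h_def c by (simp add: u_def a_def D_def w_def power_add)
      have A3: "g n = u * (1 - w) / D"
        unfolding g_def using c by (simp add: u_def a_def w_def D_def)
      show ?thesis
        unfolding A1 A2 A3 v_def[symmetric]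
        by (simp add: diff_divide_distrib[symmetric] algebra_simps)
    qed
    have g0: "g 0 = 0"
      by (simp add: g_def)
    have gS: "g (Suc n) = q ^ (k + 1) * h (k + 2) n" for n
    proof -
      have "q ^ ((Suc n)\<^sup>2 + Suc n * k) = q ^ (k + 1) * q ^ (n\<^sup>2 + n * (k + 2))"
        unfolding power_add[symmetric] by (rule arg_cong[of _ _ "power q"]) (simp add: power2_eq_square algebra_simps)
      moreover have "Suc n + k + 1 = n + (k + 2)"
        by simp
      ultimately show ?thesis
        using nS[of n] unfolding g_def h_def qS[of n] by simp
    qed
    have "g sums (q ^ (k + 1) * H (k + 2))"
      using sums_mult[OF summable_sums[OF summ[of "k + 2"]], of "q ^ (k + 1)"] g0
      unfolding H_def gS[symmetric] by (simp add: sums_Suc_iff)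
    moreover have "h (k + 1) sums H (k + 1)" "h k sums H k"
      unfolding H_def using summ by (auto intro: summable_sums)
    ultimately have "(\<lambda>n. g n - q ^ (k + 1) * h (k + 1) n) sums
        (q ^ (k + 1) * H (k + 2) - q ^ (k + 1) * H (k + 1))"
      "(\<lambda>n. h k n - h (k + 1) n) sums (H k - H (k + 1))"
      by (auto intro!: sums_diff sums_mult)
    then show ?thesis
      unfolding g using sums_unique2 by (force simp: algebra_simps)
  qed
  have iter: "norm (H k - H (k + 1)) \<le> norm q ^ m * norm (H (k + m) - H (k + m + 1))" for k m
  proof (induction m)
    case (Suc m)
    have "norm (H (k + m) - H (k + m + 1))
        = norm q ^ (k + m + 1) * norm (H (k + m + 2) - H (k + m + 1))"
      using rec[of "k + m"] by (simp add: norm_mult norm_power)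
    also have "\<dots> \<le> norm q ^ 1 * norm (H (k + m + 2) - H (k + m + 1))"
      using assms by (intro mult_right_mono power_decreasing) auto
    finally have "norm q ^ m * norm (H (k + m) - H (k + m + 1))
        \<le> norm q ^ m * (norm q * norm (H (k + Suc m) - H (k + Suc m + 1)))"
      by (intro mult_left_mono) (auto simp: norm_minus_commute)
    then show ?case
      using Suc.IH by (simp add: mult_ac)
  qed auto
  have Hconst: "H k = H (k + 1)" for k
  proof -
    define C where "C = 2 * (\<Sum>n. norm q ^ n * B\<^sup>2)"
    have "norm (H k - H (k + 1)) \<le> norm q ^ m * C" for m
    proof -
      have "norm (H (k + m) - H (k + m + 1)) \<le> C"
        using norm_triangle_ineq4[of "H (k + m)" "H (k + m + 1)"] HB[of "k + m"] HB[of "k + m + 1"]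
        unfolding C_def by linarith
      then have "norm q ^ m * norm (H (k + m) - H (k + m + 1)) \<le> norm q ^ m * C"
        by (intro mult_left_mono) auto
      then show ?thesis
        using iter[of k m] by linarith
    qed
    moreover have "(\<lambda>m. norm q ^ m * C) \<longlonglongrightarrow> 0"
      using assms by (intro tendsto_mult_left_zero LIMSEQ_power_zero) auto
    ultimately have "norm (H k - H (k + 1)) \<le> 0"
      by (intro LIMSEQ_le_const) auto
    then show ?thesis
      by simp
  qed
  have H0: "H k = H 0" for k
    by (induction k) (use Hconst in auto)
  have "(\<lambda>k. H k - 1 / qpoch q q k) \<longlonglongrightarrow> 0"
  proof (rule Lim_null_comparison[OF always_eventually[OF allI]])
    fix k
    have "H k = h k 0 + (\<Sum>n. h k (Suc n))"
      unfolding H_def suminf_split_head[OF summ[of k]] by simp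
    moreover have "h k 0 = 1 / qpoch q q k"
      by (simp add: h_def qpoch_def)
    ultimately have "H k - 1 / qpoch q q k = (\<Sum>n. h k (Suc n))"
      by simp
    moreover have "norm (\<Sum>n. h k (Suc n)) \<le> (\<Sum>n. norm q ^ k * (norm q ^ n * B\<^sup>2))"
    proof (rule norm_suminf_le)
      fix n
      have "norm (h k (Suc n)) \<le> norm q ^ (Suc n + Suc n * k) * B\<^sup>2"
        by (rule hB)
      also have "\<dots> \<le> norm q ^ (k + n) * B\<^sup>2"
        using assms by (intro mult_right_mono power_decreasing) auto
      finally show "norm (h k (Suc n)) \<le> norm q ^ k * (norm q ^ n * B\<^sup>2)"
        by (simp add: power_add mult_ac)
    qed (rule summable_mult[OF sumB])
    ultimately show "norm (H k - 1 / qpoch q q k) \<le> norm q ^ k * (\<Sum>n. norm q ^ n * B\<^sup>2)"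
      unfolding suminf_mult[OF sumB] by (simp only:)
  next
    show "(\<lambda>k. norm q ^ k * (\<Sum>n. norm q ^ n * B\<^sup>2)) \<longlonglongrightarrow> 0"
      using assms by (intro tendsto_mult_left_zero LIMSEQ_power_zero) auto
  qed
  from tendsto_add[OF this lim] have "H \<longlonglongrightarrow> 1 / qpoch_inf q q"
    by simp
  moreover have "H \<longlonglongrightarrow> H k"
    using H0 by (intro Lim_transform_eventually[OF tendsto_const] always_eventually allI) metis
  ultimately have "H k = 1 / qpoch_inf q q"
    using LIMSEQ_unique by blast
  then show ?thesis
    by (simp add: H_def h_def)
qed

text \<open>At x = 1 both tails equal (q;q)_inf / (q;q)_n, so the value is (q;q)_inf^3 times
  Cauchy's sum for k = 0.\<close>

lemma mock_K_one:
  assumes "norm q < 1"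
  shows "mock_K 1 q = (qpoch_inf q q)\<^sup>2"
proof -
  have nz: "qpoch_inf q q \<noteq> 0"
    using assms by (rule qpoch_inf_nonzero_norm) fact
  have t: "q ^ (n\<^sup>2) * (qpoch_inf (q ^ (n + 1) * 1) q * qpoch_inf (q ^ (n + 1) / 1) q)
      = (qpoch_inf q q)\<^sup>2 * (q ^ (n\<^sup>2 + n * 0) / (qpoch q q n * qpoch q q (n + 0)))" for n
  proof -
    have "qpoch_inf q q = qpoch q q n * qpoch_inf (q ^ (n + 1)) q"
      using qpoch_inf_split[OF assms, of q n] by (simp add: mult.commute)
    moreover from this have "qpoch q q n \<noteq> 0"
      using nz by auto
    ultimately show ?thesis
      by (simp add: power2_eq_square)
  qed
  have "summable (\<lambda>n. (qpoch_inf q q)\<^sup>2 * (q ^ (n\<^sup>2 + n * 0) / (qpoch q q n * qpoch q q (n + 0))))"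
    using summable_mock_K[OF assms, of 1] unfolding t .
  then have s: "summable (\<lambda>n. q ^ (n\<^sup>2 + n * 0) / (qpoch q q n * qpoch q q (n + 0)))"
    using nz by (simp only: summable_cmult_iff) simp
  show ?thesis
    unfolding mock_K_def t suminf_mult[OF s] cauchy_durfee_sum[OF assms]
    using nz by (simp add: power2_eq_square)
qed

subsection \<open>Quadratic dissections\<close>

text \<open>In this annulus every factor other than 1 - x has the form 1 - w with |w| < 1.\<close>

lemma theta_j_nonzero:
  assumes "norm q < 1" and "norm q < norm x" and "norm x < 1 / norm q" and "x \<noteq> 1"
  shows "theta_j x q \<noteq> 0"
proof -
  have "q \<noteq> 0" "x \<noteq> 0"
    using assms by auto
  then have "norm (q * x) < 1" "norm (q / x) < 1"
    using assms(2,3) by (auto simp: norm_mult norm_divide field_simps)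
  then have "qpoch_inf (q * x) q \<noteq> 0" "qpoch_inf (q / x) q \<noteq> 0" "qpoch_inf q q \<noteq> 0"
    using assms(1) by (simp_all add: qpoch_inf_nonzero_norm)
  then show ?thesis
    using assms(4) qpoch_inf_rec[OF assms(1), of x] by (simp add: theta_j_def)
qed

text \<open>\<open>F\<close> is the claimed identity multiplied by its denominators, hence free of poles; it is
  invariant under \<open>x \<mapsto> q\<^sup>2 x\<close>, so it is constant, and its value is read off at \<open>x = 1\<close>.\<close>

lemma mock_K_dissect:
  assumes q: "norm q < 1" "q \<noteq> 0" and x: "norm (q\<^sup>2) < norm x" "norm x < 1 / norm (q\<^sup>2)"
  shows "mock_K x q * theta_j (- q * x\<^sup>2) (q ^ 4) * theta_j (- q / x\<^sup>2) (q ^ 4)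
      - 1 / x * mock_K (- q * x\<^sup>2) (q ^ 4) * theta_j x q * theta_j (- q / x\<^sup>2) (q ^ 4)
      + mock_K (- q / x\<^sup>2) (q ^ 4) * theta_j x q * theta_j (- q * x\<^sup>2) (q ^ 4)
      - (1 - 1 / x) * theta_j x q * theta_j (- q * x\<^sup>2) (q ^ 4) * theta_j (- q / x\<^sup>2) (q ^ 4)
      = (qpoch_inf q q * theta_j (- q) (q ^ 4))\<^sup>2"
proof -
  define F where "F = (\<lambda>x. mock_K x q * theta_j (- q * x\<^sup>2) (q ^ 4) * theta_j (- q / x\<^sup>2) (q ^ 4)
      - 1 / x * mock_K (- q * x\<^sup>2) (q ^ 4) * theta_j x q * theta_j (- q / x\<^sup>2) (q ^ 4)
      + mock_K (- q / x\<^sup>2) (q ^ 4) * theta_j x q * theta_j (- q * x\<^sup>2) (q ^ 4)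
      - (1 - 1 / x) * theta_j x q * theta_j (- q * x\<^sup>2) (q ^ 4) * theta_j (- q / x\<^sup>2) (q ^ 4))"
  have q4: "norm (q ^ 4) < 1" "q ^ 4 \<noteq> 0"
    using q by (auto simp: norm_power power_less_one_iff)
  have q2: "norm (q\<^sup>2) < 1" "q\<^sup>2 \<noteq> 0"
    using q by (auto simp: norm_power power_less_one_iff)
  have per: "F (q\<^sup>2 * y) = F y" if y: "y \<noteq> 0" for y
  proof -
    define j1 j2 j3 k1 k2 k3 where "j1 = theta_j y q" and "j2 = theta_j (- q * y\<^sup>2) (q ^ 4)"
      and "j3 = theta_j (- q / y\<^sup>2) (q ^ 4)" and "k1 = mock_K y q"
      and "k2 = mock_K (- q * y\<^sup>2) (q ^ 4)" and "k3 = mock_K (- q / y\<^sup>2) (q ^ 4)"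
    note [simp] = q y
    have e2: "- q * (q\<^sup>2 * y)\<^sup>2 = q ^ 4 * (- q * y\<^sup>2)"
      by (simp add: power2_eq_square power4_eq_xxxx)
    have e3: "- q / (q\<^sup>2 * y)\<^sup>2 = (- q / y\<^sup>2) / q ^ 4"
      by (simp add: power2_eq_square power4_eq_xxxx)
    have s1: "theta_j (q * y) q = - j1 / y"
      using theta_j_shift[OF q, of y] by (simp add: j1_def)
    have J1: "theta_j (q\<^sup>2 * y) q = j1 / (q * y\<^sup>2)"
      using theta_j_shift[OF q, of "q * y"] s1 by (simp add: power2_eq_square mult.assoc)
    have J2: "theta_j (- q * (q\<^sup>2 * y)\<^sup>2) (q ^ 4) = j2 / (q * y\<^sup>2)"
      unfolding e2 using theta_j_shift[OF q4, of "- q * y\<^sup>2"] by (simp add: j2_def)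
    have J3: "theta_j (- q / (q\<^sup>2 * y)\<^sup>2) (q ^ 4) = j3 / (q ^ 3 * y\<^sup>2)"
      unfolding e3 using theta_j_shift_back[OF q4, of "- q / y\<^sup>2"]
      by (simp add: j3_def power4_eq_xxxx power3_eq_cube)
    \<comment> \<open>Two steps of the recurrence in base q, against a single step in base q^4 for
      the other two functions.\<close>
    have K1: "mock_K (q\<^sup>2 * y) q
        = q ^ 4 * y ^ 4 * k1 + ((1 - q ^ 3 * y\<^sup>2) / (q * y\<^sup>2) - q ^ 3 * y * (1 - q * y\<^sup>2)) * j1"
    proof -
      have "mock_K (q\<^sup>2 * y) q = q * (q * y)\<^sup>2 * mock_K (q * y) q
          - (1 - q * (q * y)\<^sup>2) / (q * y) * theta_j (q * y) q"
        using mock_K_shift[OF q, of "q * y"] by (simp add: power2_eq_square mult.assoc)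
      also have "\<dots> = q ^ 3 * y\<^sup>2 * (q * y\<^sup>2 * k1 - (1 - q * y\<^sup>2) / y * j1)
          - (1 - q ^ 3 * y\<^sup>2) / (q * y) * (- j1 / y)"
        using mock_K_shift[OF q, of y]
        by (simp add: s1 k1_def j1_def power_mult_distrib power2_eq_square power3_eq_cube)
      also have "\<dots> = q ^ 4 * y ^ 4 * k1
          + ((1 - q ^ 3 * y\<^sup>2) / (q * y\<^sup>2) - q ^ 3 * y * (1 - q * y\<^sup>2)) * j1"
        by (simp add: field_simps power2_eq_square power3_eq_cube power4_eq_xxxx)
      finally show ?thesis .
    qed
    have K2: "mock_K (- q * (q\<^sup>2 * y)\<^sup>2) (q ^ 4)
        = q ^ 6 * y ^ 4 * k2 + (1 - q ^ 6 * y ^ 4) / (q * y\<^sup>2) * j2"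
    proof -
      have "q ^ 4 * (- q * y\<^sup>2)\<^sup>2 = q ^ 6 * y ^ 4"
        by (simp add: power2_eq_square numeral_eq_Suc)
      then show ?thesis
        unfolding e2 using mock_K_shift[OF q4, of "- q * y\<^sup>2"] by (simp add: k2_def j2_def)
    qed
    \<comment> \<open>The argument -q / y^2 is divided by q^4, so the recurrence is applied at the
      new argument \<open>w\<close> and solved for the value there.\<close>
    have K3: "mock_K (- q / (q\<^sup>2 * y)\<^sup>2) (q ^ 4) = q\<^sup>2 * y ^ 4 * k3 - (q\<^sup>2 * y ^ 4 - 1) * j3"
    proof -
      define w where "w = (- q / y\<^sup>2) / q ^ 4"
      define k where "k = mock_K w (q ^ 4)"
      have w: "w \<noteq> 0" "q ^ 4 * w = - q / y\<^sup>2" "q ^ 4 * w\<^sup>2 = 1 / (q\<^sup>2 * y ^ 4)"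
        by (simp_all add: w_def field_simps power2_eq_square power4_eq_xxxx)
      have "k3 = q ^ 4 * w\<^sup>2 * k - (1 - q ^ 4 * w\<^sup>2) / w * theta_j w (q ^ 4)"
        using mock_K_shift[OF q4 w(1)] by (simp add: k_def k3_def w(2))
      also have "theta_j w (q ^ 4) = - w * j3"
        using theta_j_shift_back[OF q4, of "- q / y\<^sup>2"] by (simp add: j3_def w_def)
      finally have "k3 = k / (q\<^sup>2 * y ^ 4) + (1 - 1 / (q\<^sup>2 * y ^ 4)) * j3"
        unfolding w(3) using w(1) by simp
      then have "q\<^sup>2 * y ^ 4 * k3 = k + (q\<^sup>2 * y ^ 4 - 1) * j3"
        by (simp add: field_simps)
      then show ?thesis
        unfolding e3 w_def[symmetric] k_def[symmetric] by (simp add: algebra_simps)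
    qed
    have "F (q\<^sup>2 * y) = k1 * j2 * j3 - 1 / y * k2 * j1 * j3 + k3 * j1 * j2 - (1 - 1 / y) * j1 * j2 * j3"
      unfolding F_def J1 J2 J3 K1 K2 K3
      by (simp add: divide_simps) (simp add: algebra_simps numeral_eq_Suc)
    then show ?thesis
      by (simp add: F_def j1_def j2_def j3_def k1_def k2_def k3_def)
  qed
  let ?S = "{z::complex. norm (q\<^sup>2) < norm z \<and> norm z < 1 / norm (q\<^sup>2)}"
  have "F holomorphic_on ?S"
    unfolding F_def using q q4 by (intro holomorphic_intros) auto
  then have "F constant_on ?S"
  proof (rule holomorphic_q_periodic_constant[OF q2(2,1)])
    show "F (q\<^sup>2 * z) = F z" if "1 < norm z" for z
      using per[of z] that by (cases "z = 0") auto
  qed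
  moreover have "1 \<in> ?S" "x \<in> ?S"
    using q2 x by auto
  ultimately have "F x = F 1"
    by (auto simp: constant_on_def)
  \<comment> \<open>At x = 1 the factor j(x;q) vanishes, which leaves only the first product; its
    two theta functions are both j(-q;q^4) there.\<close>
  also have "\<dots> = (qpoch_inf q q * theta_j (- q) (q ^ 4))\<^sup>2"
    using mock_K_one[OF q(1)] qpoch_inf_one[OF q(1)]
    by (simp add: F_def theta_j_def power_mult_distrib power2_eq_square)
  finally show ?thesis
    by (simp add: F_def)
qed

lemma mock_A_dissect:
  assumes q: "norm q < 1" "q \<noteq> 0" and x: "norm (q\<^sup>2) < norm x" "norm x < 1 / norm (q\<^sup>2)"
    and nz: "theta_j x q \<noteq> 0" "theta_j (- q * x\<^sup>2) (q ^ 4) \<noteq> 0" "theta_j (- q / x\<^sup>2) (q ^ 4) \<noteq> 0"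
  shows "mock_A x q - mock_A (- q * x\<^sup>2) (q ^ 4) / x + mock_A (- q / x\<^sup>2) (q ^ 4) - 1 + 1 / x
    = (qpoch_inf q q * theta_j (- q) (q ^ 4))\<^sup>2 /
      (theta_j x q * theta_j (- q * x\<^sup>2) (q ^ 4) * theta_j (- q / x\<^sup>2) (q ^ 4))"
proof -
  have q4: "norm (q ^ 4) < 1"
    using q by (simp add: norm_power power_less_one_iff)
  define j1 j2 j3 a1 a2 a3 where "j1 = theta_j x q" and "j2 = theta_j (- q * x\<^sup>2) (q ^ 4)"
    and "j3 = theta_j (- q / x\<^sup>2) (q ^ 4)" and "a1 = mock_A x q"
    and "a2 = mock_A (- q * x\<^sup>2) (q ^ 4)" and "a3 = mock_A (- q / x\<^sup>2) (q ^ 4)"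
  have "(qpoch_inf q q * theta_j (- q) (q ^ 4))\<^sup>2
      = (j1 * a1) * j2 * j3 - 1 / x * (j2 * a2) * j1 * j3 + (j3 * a3) * j1 * j2
        - (1 - 1 / x) * j1 * j2 * j3"
    unfolding mock_K_dissect[OF q x, symmetric] mock_K_eq[OF q(1) nz(1)] mock_K_eq[OF q4 nz(2)]
      mock_K_eq[OF q4 nz(3)] j1_def j2_def j3_def a1_def a2_def a3_def ..
  also have "\<dots> = (a1 - a2 / x + a3 - 1 + 1 / x) * (j1 * j2 * j3)"
    by (simp add: algebra_simps)
  finally show ?thesis
    using nz by (simp add: a1_def a2_def a3_def j1_def j2_def j3_def)
qed

text \<open>In the series for j(x;q), these are the terms with even and with odd exponent of x. For
  the products, the right-hand side \<open>E\<close> obeys the same functional equation under x ->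
  qx as j(x;q), so their quotient is constant once its singularity at x = 1 is removed.\<close>

lemma theta_j_dissect:
  assumes q: "norm q < 1" "q \<noteq> 0" and x: "norm q < norm x" "norm x < 1 / norm q"
  shows "theta_j x q = theta_j (- q * x\<^sup>2) (q ^ 4) - x * theta_j (- (q ^ 3) * x\<^sup>2) (q ^ 4)"
proof -
  have q4: "norm (q ^ 4) < 1" "q ^ 4 \<noteq> 0" and q2: "norm (q\<^sup>2) < 1"
    using q by (auto simp: norm_power power_less_one_iff)
  define E where "E = (\<lambda>x. theta_j (- q * x\<^sup>2) (q ^ 4) - x * theta_j (- (q ^ 3) * x\<^sup>2) (q ^ 4))"
  define d where "d = (\<lambda>x. qpoch_inf (q * x) q * qpoch_inf (q / x) q * qpoch_inf q q)"
  \<comment> \<open>This is -E(z) / j(z;q), the sign coming from z - 1 against 1 - z. Since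
    \<open>d\<close> lacks the factor 1 - z it has no zero in the annulus, and since E(1) = 0 the
    derivative fills the removable singularity.\<close>
  define h where "h = (\<lambda>z. (if z = 1 then deriv E 1 else (E z - E 1) / (z - 1)) / d z)"
  let ?S = "{z::complex. norm q < norm z \<and> norm z < 1 / norm q}"
  have S0: "z \<noteq> 0" if "z \<in> ?S" for z
    using that by auto
  have theta: "theta_j z q = (1 - z) * d z" for z
    using qpoch_inf_rec[OF q(1), of z] by (simp add: theta_j_def d_def)
  have E1: "E 1 = 0"
    using theta_j_reflect[of "q ^ 4" "- q"] q by (simp add: E_def numeral_eq_Suc)
  have hE: "h z = - (E z / theta_j z q)" if "z \<noteq> 1" for z
  proof -
    have "- (E z / theta_j z q) = E z / (z - 1) / d z"
      unfolding theta using that by (auto simp: divide_simps algebra_simps)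
    then show ?thesis
      using that by (simp add: h_def E1)
  qed
  have Eshift: "E (q * z) = - E z / z" if "z \<noteq> 0" for z
  proof -
    define t1 t3 where "t1 = theta_j (- q * z\<^sup>2) (q ^ 4)" and "t3 = theta_j (- (q ^ 3) * z\<^sup>2) (q ^ 4)"
    have e: "- q * (q * z)\<^sup>2 = - (q ^ 3) * z\<^sup>2" "- (q ^ 3) * (q * z)\<^sup>2 = q ^ 4 * (- q * z\<^sup>2)"
      by (simp_all add: power2_eq_square power3_eq_cube power4_eq_xxxx)
    have "theta_j (q ^ 4 * (- q * z\<^sup>2)) (q ^ 4) = t1 / (q * z\<^sup>2)"
      using theta_j_shift[OF q4, of "- q * z\<^sup>2"] that q by (simp add: t1_def)
    then have "E (q * z) = t3 - q * z * (t1 / (q * z\<^sup>2))"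
      unfolding E_def e by (simp add: t3_def)
    also have "\<dots> = - (t1 - z * t3) / z"
      using that q by (simp add: field_simps power2_eq_square)
    also have "t1 - z * t3 = E z"
      by (simp add: E_def t1_def t3_def)
    finally show ?thesis .
  qed
  have dz: "d z \<noteq> 0" if "z \<in> ?S" for z
  proof -
    have "norm (q * z) < 1" "norm (q / z) < 1"
      using that q S0[OF that] by (auto simp: norm_mult norm_divide field_simps)
    then show ?thesis
      unfolding d_def using q by (simp add: qpoch_inf_nonzero_norm)
  qed
  have per: "h (q * z) = h z" if "1 < norm z" "norm z < 1 / norm q" for z
  proof -
    have "z \<noteq> 0" "z \<noteq> 1" "norm (q * z) < 1"
      using that q by (auto simp: norm_mult field_simps)
    moreover from this have "q * z \<noteq> 1"
      by auto
    ultimately show ?thesis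
      using hE[of "q * z"] hE[of z] Eshift[of z] theta_j_shift[OF q, of z] by simp
  qed
  have oS: "open ?S"
    by (intro open_Collect_conj open_Collect_less continuous_intros)
  have 1: "1 \<in> ?S"
    using q by auto
  have "E holomorphic_on ?S"
    unfolding E_def using q4 q by (intro holomorphic_intros) auto
  then have "h holomorphic_on ?S"
    unfolding h_def using oS 1 dz q
    by (intro holomorphic_on_divide pole_lemma)
       (auto simp: d_def interior_open intro!: holomorphic_intros)
  then have "h constant_on ?S"
    using per by (intro holomorphic_q_periodic_constant[OF q(2,1)]) auto
  then obtain c where c: "\<And>z. z \<in> ?S \<Longrightarrow> h z = c"
    by (auto simp: constant_on_def)
  \<comment> \<open>With r^2 = -q, the second theta function in \<open>E\<close> becomes j(q^4;q^4)
    = 0, and q/r = -r lets the two products in j(r;q) combine into one in base q^2. Hence both sides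
    are computable at r.\<close>
  define r where "r = \<i> * csqrt q"
  have r2: "r\<^sup>2 = - q"
    by (simp add: r_def power_mult_distrib)
  have rS: "r \<in> ?S"
  proof -
    have nr: "norm r * norm r = norm q"
      by (metis norm_minus_cancel norm_mult power2_eq_square r2)
    have "norm r < 1"
    proof (rule ccontr)
      assume "\<not> norm r < 1"
      then have "1 * 1 \<le> norm r * norm r"
        by (intro mult_mono) auto
      then show False
        using nr q by simp
    qed
    moreover have "0 < norm r"
      using nr q by auto
    ultimately have "norm r * norm r < norm r * 1" "norm r * norm q < 1 * 1"
      using q by (intro mult_strict_left_mono mult_strict_mono; simp)+
    then show ?thesis
      using nr q by (simp add: pos_less_divide_eq)
  qed
  have "norm (r\<^sup>2) < 1"
    using q by (simp add: r2)
  then have r: "r \<noteq> 1" "r \<noteq> 0"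
    using S0[OF rS] by auto
  have "E r = theta_j r q"
  proof -
    have "q / r = - r"
      using r2 r by (simp add: field_simps power2_eq_square)
    then have "theta_j r q = qpoch_inf (- q) (q\<^sup>2) * qpoch_inf q q"
      using qpoch_inf_mult_minus[OF q(1), of r] r2 by (simp add: theta_j_def)
    also have "\<dots> = qpoch_inf q (q\<^sup>2) * qpoch_inf (- q) (q\<^sup>2) * qpoch_inf (q\<^sup>2) (q\<^sup>2)"
      using qpoch_inf_dissect2[OF q(1), of q] by (simp add: power2_eq_square)
    also have "qpoch_inf q (q\<^sup>2) * qpoch_inf (- q) (q\<^sup>2) = qpoch_inf (q\<^sup>2) (q ^ 4)"
      using qpoch_inf_mult_minus[OF q2, of q] by simp
    also have "qpoch_inf (q\<^sup>2) (q\<^sup>2) = qpoch_inf (q\<^sup>2) (q ^ 4) * qpoch_inf (q ^ 4) (q ^ 4)"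
      using qpoch_inf_dissect2[OF q2, of "q\<^sup>2"] by (simp flip: power_add power_mult)
    also have "qpoch_inf (q\<^sup>2) (q ^ 4) * (qpoch_inf (q\<^sup>2) (q ^ 4) * qpoch_inf (q ^ 4) (q ^ 4))
        = theta_j (q\<^sup>2) (q ^ 4)"
      using q by (simp add: theta_j_def power2_eq_square power4_eq_xxxx)
    finally have "theta_j r q = theta_j (q\<^sup>2) (q ^ 4)" .
    moreover have "theta_j (q ^ 4) (q ^ 4) = 0"
      using q q4 by (simp add: theta_j_def qpoch_inf_one)
    moreover have "- q * r\<^sup>2 = q\<^sup>2" "- (q ^ 3) * r\<^sup>2 = q ^ 4"
      unfolding r2 by (simp_all add: numeral_eq_Suc)
    ultimately show ?thesis
      by (simp add: E_def)
  qed
  moreover have "theta_j r q \<noteq> 0"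
    using theta_j_nonzero[OF q(1)] rS r by auto
  ultimately have "c = - 1"
    using c[OF rS] hE[OF r(1)] by simp
  show ?thesis
  proof (cases "x = 1")
    case True
    then show ?thesis
      using E1 theta[of 1] by (simp add: E_def)
  next
    case False
    then have "E x = theta_j x q"
      using c[of x] hE[of x] \<open>c = - 1\<close> x theta_j_nonzero[OF q(1) x] by simp
    then show ?thesis
      by (simp add: E_def)
  qed
qed

subsection \<open>The even and odd parts of \<open>\<phi>\<close>\<close>

lemma norm_power_less_1:
  fixes q :: complex
  assumes "norm q < 1" and "n > 0"
  shows "norm (q ^ n) < 1"
  using assms by (simp add: norm_power power_less_one_iff)

text \<open>J_{2,6} consists of the three residue classes modulo 3 of the factors of (q^2;q^2)_inf,
  which is also the last factor of J_{1,2}.\<close>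

lemma theta_J_quotient:
  assumes q: "norm q < 1" "q \<noteq> 0"
  shows "theta_J q 1 2 / theta_J1 q 2 = (qpoch_inf q (q\<^sup>2))\<^sup>2"
proof -
  have q2: "norm (q\<^sup>2) < 1"
    using q by (intro norm_power_less_1) auto
  have nz: "qpoch_inf (q\<^sup>2) (q\<^sup>2) \<noteq> 0"
    using q2 by (rule qpoch_inf_nonzero_norm) fact
  have "theta_J q 1 2 = (qpoch_inf q (q\<^sup>2))\<^sup>2 * qpoch_inf (q\<^sup>2) (q\<^sup>2)"
    using q by (simp add: theta_J_def theta_j_def power2_eq_square)
  moreover have "theta_J1 q 2 = qpoch_inf (q\<^sup>2) (q\<^sup>2)"
  proof -
    have "q ^ 6 / q\<^sup>2 = q ^ 4"
      using q by (simp add: numeral_eq_Suc)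
    moreover have "qpoch_inf (q\<^sup>2) (q\<^sup>2) = qpoch_inf (q\<^sup>2) (q ^ 6) * qpoch_inf (q ^ 4) (q ^ 6) * qpoch_inf (q ^ 6) (q ^ 6)"
    proof -
      have "{..<3::nat} = {0, 1, 2}" and e: "q\<^sup>2 * q\<^sup>2 = q ^ 4" "q ^ 4 * q\<^sup>2 = q ^ 6"
        by (auto simp: numeral_eq_Suc)
      then show ?thesis
        using qpoch_inf_dissect[OF q2, of 3 "q\<^sup>2"] e by (simp flip: power_mult)
    qed
    ultimately show ?thesis
      by (simp add: theta_J1_def theta_J_def theta_j_def)
  qed
  ultimately show ?thesis
    using nz by simp
qed

text \<open>Ramanujan's third order mock theta function \<open>\<phi>\<close>.\<close>

definition mock_phi :: "complex \<Rightarrow> complex" where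
  "mock_phi p = (\<Sum>n. p ^ (n\<^sup>2) / qpoch (- (p\<^sup>2)) (p\<^sup>2) n)"

lemma norm_i_less: "norm q < 1 \<Longrightarrow> q \<noteq> 0 \<Longrightarrow> norm q < norm \<i> \<and> norm \<i> < 1 / norm q"
  by simp

text \<open>As 1/i = -i, the factors of (ip;p)_n and (p/i;p)_n pair to 1 + p^(2k). The remaining
  first factor of (i;p)_{n+1} is the constant 1 - i.\<close>

lemma sums_mock_phi:
  assumes p: "norm p < 1" "p \<noteq> 0"
  shows "(\<lambda>n. p ^ (n\<^sup>2) / qpoch (- (p\<^sup>2)) (p\<^sup>2) n) sums mock_phi p"
    and "mock_phi p = (1 - \<i>) * mock_A \<i> p"
proof -
  have nz: "theta_j \<i> p \<noteq> 0"
    using norm_i_less[OF p] p by (intro theta_j_nonzero) (auto simp: complex_eq_iff)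
  have t: "p ^ (n\<^sup>2) / qpoch (- (p\<^sup>2)) (p\<^sup>2) n
      = (1 - \<i>) * (p ^ (n\<^sup>2) / (qpoch \<i> p (n + 1) * qpoch (p / \<i>) p n))" for n
  proof -
    have "qpoch \<i> p (n + 1) = (1 - \<i>) * qpoch (p * \<i>) p n"
      by (simp add: qpoch_def prod.lessThan_Suc_shift mult_ac del: prod.lessThan_Suc)
    moreover have "qpoch (p * \<i>) p n * qpoch (p / \<i>) p n = qpoch (- (p\<^sup>2)) (p\<^sup>2) n"
      unfolding qpoch_def prod.distrib[symmetric]
      by (rule prod.cong) (simp_all add: algebra_simps power2_eq_square power_mult_distrib)
    moreover have "1 - \<i> \<noteq> 0"
      by (simp add: complex_eq_iff)
    ultimately show ?thesis
      by (simp add: mult.assoc)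
  qed
  have "(\<lambda>n. p ^ (n\<^sup>2) / qpoch (- (p\<^sup>2)) (p\<^sup>2) n) sums ((1 - \<i>) * mock_A \<i> p)"
    unfolding t mock_A_def using sums_mock_A[OF p(1) nz] by (intro sums_mult) (simp add: sums_iff)
  then show "(\<lambda>n. p ^ (n\<^sup>2) / qpoch (- (p\<^sup>2)) (p\<^sup>2) n) sums mock_phi p"
    and "mock_phi p = (1 - \<i>) * mock_A \<i> p"
    unfolding mock_phi_def by (simp_all add: sums_iff)
qed

text \<open>The denominators involve only p^2, and (-p)^(n^2) has the sign of (-1)^n, so the half
  sum and half difference select the even and the odd n.\<close>

lemma psibar_eq_mock_phi:
  assumes p: "norm p < 1" "p \<noteq> 0"
  shows "psibar0 (p\<^sup>2) = (mock_phi p + mock_phi (- p)) / 2"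
    and "psibar1 (p\<^sup>2) = (mock_phi p - mock_phi (- p)) / (2 * p)"
proof -
  let ?f = "\<lambda>n. p ^ (n\<^sup>2) / qpoch (- (p\<^sup>2)) (p\<^sup>2) n"
  let ?g = "\<lambda>n. (- p) ^ (n\<^sup>2) / qpoch (- (p\<^sup>2)) (p\<^sup>2) n"
  have f: "?f sums mock_phi p" and g: "?g sums mock_phi (- p)"
    using sums_mock_phi(1)[of p] sums_mock_phi(1)[of "- p"] p by simp_all
  have even: "(- p) ^ ((n * 2)\<^sup>2) = p ^ ((n * 2)\<^sup>2)" for n
    by (rule power_minus_even) simp
  have odd: "(- p) ^ ((Suc (n * 2))\<^sup>2) = - (p ^ ((Suc (n * 2))\<^sup>2))" for n
    by (rule power_minus_odd) simp
  have *: "{n * 2..<n * 2 + 2} = {n * 2, Suc (n * 2)}" for n :: nat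
    by auto
  have f2: "(\<lambda>n. ?f (n * 2) + ?f (Suc (n * 2))) sums mock_phi p"
    using sums_group[OF f, of 2] by (simp add: *)
  have g2: "(\<lambda>n. ?f (n * 2) - ?f (Suc (n * 2))) sums mock_phi (- p)"
    using sums_group[OF g, of 2] by (simp add: * even odd)
  have "(\<lambda>n. ?f (n * 2)) sums ((mock_phi p + mock_phi (- p)) / 2)"
    using sums_divide[OF sums_add[OF f2 g2], of 2] by simp
  moreover have "?f (n * 2) = (p\<^sup>2) ^ (2 * n\<^sup>2) / qpoch (- (p\<^sup>2)) (p\<^sup>2) (2 * n)" for n
    by (simp add: power_mult_distrib mult.commute flip: power_mult)
  ultimately show "psibar0 (p\<^sup>2) = (mock_phi p + mock_phi (- p)) / 2"
    unfolding psibar0_def by (simp add: sums_iff)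
  have "(\<lambda>n. ?f (Suc (n * 2)) / p) sums ((mock_phi p - mock_phi (- p)) / 2 / p)"
    using sums_divide[OF sums_divide[OF sums_diff[OF f2 g2], of 2], of p] by simp
  moreover have "?f (Suc (n * 2)) / p
      = (p\<^sup>2) ^ (2 * n\<^sup>2 + 2 * n) / qpoch (- (p\<^sup>2)) (p\<^sup>2) (2 * n + 1)" for n
  proof -
    have "(Suc (n * 2))\<^sup>2 = Suc (2 * (2 * n\<^sup>2 + 2 * n))"
      by (simp add: power2_eq_square algebra_simps)
    then show ?thesis
      using p by (simp add: mult.commute flip: power_mult)
  qed
  ultimately show "psibar1 (p\<^sup>2) = (mock_phi p - mock_phi (- p)) / (2 * p)"
    unfolding psibar1_def by (simp add: sums_iff)
qed

text \<open>At x = i the coefficient of A(p;p^4) is (1 - i)(1 - 1/i) = 2, so subtracting twice the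
  dissection at x = p in base p^4 eliminates this series. What remains is to simplify a difference
  of two theta quotients.\<close>

lemma mock_phi_eq:
  assumes p: "norm p < 1" "p \<noteq> 0"
  shows "mock_phi p = 2 * mock_A (- (p\<^sup>2)) (p ^ 16) + 2 / p * (1 - mock_A (- (p ^ 6)) (p ^ 16))
    - (qpoch_inf (p\<^sup>2) (p ^ 4))\<^sup>2 * theta_j p (p ^ 4)"
proof -
  have pn: "norm (p ^ n) < 1" "p ^ n \<noteq> 0" if "n > 0" for n
    using p that by (auto intro: norm_power_less_1)
  have plt: "norm (p ^ n) < norm (p ^ m)" if "m < n" for m n
    using p that by (simp add: norm_power power_strict_decreasing)
  have pinv: "norm (p ^ m) < 1 / norm (p ^ n)" if "n > 0" for m n
  proof -
    have "norm (p ^ m * p ^ n) < 1"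
      using norm_power_less_1[OF p(1), of "m + n"] that by (simp add: power_add)
    then show ?thesis
      using p by (simp add: norm_mult pos_less_divide_eq)
  qed
  have tnz: "theta_j x (p ^ n) \<noteq> 0" if "norm x = norm (p ^ m)" "0 < m" "m < n" for x m n
  proof (rule theta_j_nonzero)
    show "norm (p ^ n) < 1" "norm (p ^ n) < norm x" "norm x < 1 / norm (p ^ n)" "x \<noteq> 1"
      using that pn[of n] pn[of m] plt[of m n] pinv[of n m] by auto
  qed
  \<comment> \<open>The theta functions in both quotients, or the products of them that occur,
    become constant multiples of monomials in these infinite products.\<close>
  define a b c d e s u f t where "a = qpoch_inf p (p\<^sup>2)" and "b = qpoch_inf (- p) (p\<^sup>2)"
    and "c = qpoch_inf (p\<^sup>2) (p ^ 4)" and "d = qpoch_inf (- (p\<^sup>2)) (p ^ 4)"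
    and "e = qpoch_inf (- (p ^ 4)) (p ^ 8)" and "s = qpoch_inf (p ^ 4) (p ^ 4)"
    and "u = qpoch_inf (p ^ 8) (p ^ 8)" and "f = qpoch_inf (p ^ 4) (p ^ 8)"
    and "t = qpoch_inf (p ^ 16) (p ^ 16)"
  have nz: "a \<noteq> 0" "b \<noteq> 0" "c \<noteq> 0" "d \<noteq> 0" "s \<noteq> 0" "u \<noteq> 0" "f \<noteq> 0" "t \<noteq> 0"
    unfolding a_def b_def c_def d_def s_def u_def f_def t_def
    using p pn by (simp_all add: qpoch_inf_nonzero_norm)
  have cd: "c * d = f"
    using qpoch_inf_mult_minus[OF pn(1), of 4 "p\<^sup>2"]
    by (simp add: c_def d_def f_def flip: power_mult)
  have p2: "qpoch_inf (p\<^sup>2) (p\<^sup>2) = c * s"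
    using qpoch_inf_dissect2[OF pn(1), of 2 "p\<^sup>2"]
    by (simp add: c_def s_def flip: power_mult power_add)
  have p1: "qpoch_inf p p = a * c * s"
    using qpoch_inf_dissect2[OF p(1), of p] by (simp add: a_def p2 flip: power2_eq_square)
  have s: "s = f * u"
    using qpoch_inf_dissect2[OF pn(1), of 4 "p ^ 4"]
    by (simp add: s_def f_def u_def flip: power_mult power_add)
  \<comment> \<open>Euler's identity (x;x^2)_inf (-x;x)_inf = 1 at x = p^2.\<close>
  have m2: "c * qpoch_inf (- (p\<^sup>2)) (p\<^sup>2) = 1"
    using qpoch_inf_mult_minus[OF pn(1), of 2 "p\<^sup>2"] nz
    by (simp add: p2 s_def[symmetric] flip: power_mult)
  have q3: "p ^ 4 / p = p ^ 3" "p ^ 4 / - p = - (p ^ 3)" "p\<^sup>2 * p = p ^ 3" "(p\<^sup>2)\<^sup>2 = p ^ 4"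
    using p by (simp_all add: numeral_eq_Suc)
  have th_p: "theta_j p (p ^ 4) = a * s"
    using qpoch_inf_dissect2[OF pn(1), of 2 p]
    by (simp add: theta_j_def a_def s_def q3)
  have th_mp: "theta_j (- p) (p ^ 4) = b * s"
    using qpoch_inf_dissect2[OF pn(1), of 2 "- p"]
    by (simp add: theta_j_def b_def s_def q3)
  have th_i: "theta_j \<i> p = (1 - \<i>) * (a * s)"
  proof -
    have "theta_j \<i> p = (1 - \<i>) * (qpoch_inf (p * \<i>) p * qpoch_inf (- (p * \<i>)) p) * (a * c * s)"
      using qpoch_inf_rec[OF p(1), of \<i>] by (simp add: theta_j_def p1 mult.commute[of \<i> p])
    also have "qpoch_inf (p * \<i>) p * qpoch_inf (- (p * \<i>)) p = qpoch_inf (- (p\<^sup>2)) (p\<^sup>2)"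
      using qpoch_inf_mult_minus[OF p(1), of "p * \<i>"] by (simp add: power_mult_distrib)
    finally show ?thesis
      using m2 by (simp add: mult_ac)
  qed
  have th_4: "theta_j (- (p ^ 4)) (p ^ 16) = e * t"
  proof -
    have "p ^ 16 / p ^ 4 = p ^ 12"
      using p by (simp add: numeral_eq_Suc)
    then show ?thesis
      using qpoch_inf_dissect2[OF pn(1), of 8 "- (p ^ 4)"]
      by (simp add: theta_j_def e_def t_def flip: power_mult power_add)
  qed
  have th_26: "theta_j (- (p ^ 6)) (p ^ 16) * theta_j (- (p\<^sup>2)) (p ^ 16) = d * t\<^sup>2"
  proof -
    have "p ^ 16 / p ^ 6 = p ^ 10" "p ^ 16 / p\<^sup>2 = p ^ 14"
      using p by (simp_all add: numeral_eq_Suc)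
    moreover have "d = qpoch_inf (- (p\<^sup>2)) (p ^ 16) * qpoch_inf (- (p ^ 6)) (p ^ 16)
        * qpoch_inf (- (p ^ 10)) (p ^ 16) * qpoch_inf (- (p ^ 14)) (p ^ 16)"
    proof -
      have "{..<4::nat} = {0, 1, 2, 3}"
        and e: "p ^ 4 * p\<^sup>2 = p ^ 6" "p ^ 8 * p\<^sup>2 = p ^ 10" "p ^ 12 * p\<^sup>2 = p ^ 14"
        by (auto simp: numeral_eq_Suc)
      then show ?thesis
        using qpoch_inf_dissect[OF pn(1), of 4 4 "- (p\<^sup>2)"]
        by (simp add: d_def e flip: power_mult)
    qed
    ultimately show ?thesis
      by (simp add: theta_j_def t_def power2_eq_square mult_ac)
  qed
  \<comment> \<open>The one additive relation needed: the odd parts cancel between the dissections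
    of j(x;p^2) at x = p and x = -p. For \<theta>(p), the sum of p^(n^2) over all integers n, it
    reads \<theta>(p) + \<theta>(-p) = 2 \<theta>(p^4).\<close>
  have theta3: "(a\<^sup>2 + b\<^sup>2) * (c * s) = 2 * (e\<^sup>2 * u)"
  proof -
    have r: "norm (p\<^sup>2) < norm p" "norm p < 1 / norm (p\<^sup>2)"
      using plt[of 1 2] pinv[of 2 1] by auto
    have "theta_j p (p\<^sup>2) + theta_j (- p) (p\<^sup>2) = 2 * theta_j (- (p ^ 4)) (p ^ 8)"
      using theta_j_dissect[OF pn[of 2], of p] theta_j_dissect[OF pn[of 2], of "- p"] r
      by (simp add: flip: power_mult power_add)
    moreover have "theta_j p (p\<^sup>2) = a\<^sup>2 * (c * s)" "theta_j (- p) (p\<^sup>2) = b\<^sup>2 * (c * s)"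
    proof -
      have "p\<^sup>2 / p = p" "p\<^sup>2 / - p = - p"
        using p by (simp_all add: power2_eq_square)
      then show "theta_j p (p\<^sup>2) = a\<^sup>2 * (c * s)" "theta_j (- p) (p\<^sup>2) = b\<^sup>2 * (c * s)"
        by (simp_all add: theta_j_def p2 a_def b_def power2_eq_square[of "qpoch_inf _ _"])
    qed
    moreover have "theta_j (- (p ^ 4)) (p ^ 8) = e\<^sup>2 * u"
    proof -
      have "p ^ 8 / p ^ 4 = p ^ 4"
        using p by (simp add: numeral_eq_Suc)
      then show ?thesis
        by (simp add: theta_j_def e_def u_def power2_eq_square)
    qed
    ultimately show ?thesis
      by (simp add: algebra_simps)
  qed
  have "norm (p\<^sup>2) < norm \<i> \<and> norm \<i> < 1 / norm (p\<^sup>2)"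
    using pn[of 2] by (intro norm_i_less) auto
  then have A1: "mock_A \<i> p - mock_A p (p ^ 4) / \<i> + mock_A p (p ^ 4) - 1 + 1 / \<i>
      = (a * c * s * (b * s))\<^sup>2 / ((1 - \<i>) * (a * s) * (a * s) * (a * s))"
    using mock_A_dissect[OF p, of \<i>] nz by (simp add: p1 th_i th_p th_mp)
  have T1: "mock_phi p + 2 * mock_A p (p ^ 4) - 2 = c\<^sup>2 * b\<^sup>2 * s / a"
  proof -
    have i: "1 - \<i> \<noteq> 0"
      by (simp add: complex_eq_iff)
    have "mock_phi p + 2 * mock_A p (p ^ 4) - 2
        = (1 - \<i>) * (mock_A \<i> p - mock_A p (p ^ 4) / \<i> + mock_A p (p ^ 4) - 1 + 1 / \<i>)"
      unfolding sums_mock_phi(2)[OF p] by (simp add: algebra_simps)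
    also have "\<dots> = c\<^sup>2 * b\<^sup>2 * s / a"
      unfolding A1 using nz i by (simp add: field_simps power2_eq_square)
    finally show ?thesis .
  qed
  have D2: "mock_A p (p ^ 4) - mock_A (- (p ^ 6)) (p ^ 16) / p + mock_A (- (p\<^sup>2)) (p ^ 16) - 1 + 1 / p
      = s * e\<^sup>2 / (a * d)"
  proof -
    have e1: "- (p ^ 4) * p\<^sup>2 = - (p ^ 6)" "- (p ^ 4) / p\<^sup>2 = - (p\<^sup>2)" "(p ^ 4) ^ 4 = p ^ 16" "(p ^ 4)\<^sup>2 = p ^ 8"
      using p by (simp_all add: numeral_eq_Suc)
    have "mock_A p (p ^ 4) - mock_A (- (p ^ 6)) (p ^ 16) / p + mock_A (- (p\<^sup>2)) (p ^ 16) - 1 + 1 / p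
      = (s * (e * t))\<^sup>2 / (a * s * theta_j (- (p ^ 6)) (p ^ 16) * theta_j (- (p\<^sup>2)) (p ^ 16))"
      using mock_A_dissect[OF pn[of 4], of p, unfolded e1] plt[of 1 8] pinv[of 8 1]
        tnz[of p 1 4] tnz[of "- (p ^ 6)" 6 16] tnz[of "- (p\<^sup>2)" 2 16]
      by (simp add: s_def[symmetric] th_4 th_p)
    also have "\<dots> = s * e\<^sup>2 / (a * d)"
      unfolding mult.assoc[of "a * s"] th_26 using nz by (simp add: field_simps power2_eq_square)
    finally show ?thesis .
  qed
  \<comment> \<open>By \<open>theta3\<close> the second quotient splits into a part with b^2, which
    cancels the first quotient, and a part with a^2, which is c^2 j(p;p^4).\<close>
  have "c\<^sup>2 * b\<^sup>2 * s / a - 2 * (s * e\<^sup>2 / (a * d)) = - (c\<^sup>2 * (a * s))"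
  proof -
    have "(a\<^sup>2 + b\<^sup>2) * c * f * u = 2 * e\<^sup>2 * u"
      using theta3 by (simp add: s mult_ac)
    then have "(a\<^sup>2 + b\<^sup>2) * c * (c * d) = 2 * e\<^sup>2"
      using nz by (simp add: cd)
    then have "2 * (s * e\<^sup>2 / (a * d)) = s * ((a\<^sup>2 + b\<^sup>2) * c * (c * d)) / (a * d)"
      by simp
    also have "\<dots> = c\<^sup>2 * b\<^sup>2 * s / a + c\<^sup>2 * (a * s)"
      using nz by (simp add: field_simps power2_eq_square)
    finally show ?thesis
      by simp
  qed
  then have "mock_phi p + 2 * mock_A p (p ^ 4) - 2
      - 2 * (mock_A p (p ^ 4) - mock_A (- (p ^ 6)) (p ^ 16) / p + mock_A (- (p\<^sup>2)) (p ^ 16) - 1 + 1 / p)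
      = - (c\<^sup>2 * theta_j p (p ^ 4))"
    unfolding T1 D2 th_p .
  then show ?thesis
    unfolding c_def by (simp add: algebra_simps diff_divide_distrib)
qed

lemma mock_g_eq: "mock_g x q = (mock_A x q - 1) / x"
  unfolding mock_g_def mock_A_def[symmetric] by (simp add: divide_inverse mult.commute)

theorem theorem1p6:
  fixes q :: complex
  assumes "q \<noteq> 0" and "norm q < 1"
  shows "psibar0 q = 2 - 2 * q * mock_g (- q) (q ^ 8)
           - theta_J q 1 2 * theta_Jbar q 3 8 / theta_J1 q 2
       \<and> psibar1 q = 2 * q\<^sup>2 * mock_g (- (q ^ 3)) (q ^ 8)
           + theta_J q 1 2 * theta_Jbar q 1 8 / theta_J1 q 2"
proof -
  define p where "p = csqrt q"
  have q: "q = p\<^sup>2"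
    by (simp add: p_def)
  have p: "norm p < 1" "p \<noteq> 0"
  proof -
    show "p \<noteq> 0"
      using assms(1) q by auto
    have "(norm p)\<^sup>2 < 1"
      using assms(2) by (simp add: q norm_power)
    then show "norm p < 1"
      by (simp add: abs_square_less_1)
  qed
  have pows: "q\<^sup>2 = p ^ 4" "q ^ 3 = p ^ 6" "q ^ 8 = p ^ 16"
    by (simp_all add: q flip: power_mult)
  define A1 A3 J1 J3 where "A1 = mock_A (- q) (q ^ 8)" and "A3 = mock_A (- (q ^ 3)) (q ^ 8)"
    and "J1 = theta_j (- q) (q ^ 8)" and "J3 = theta_j (- (q ^ 3)) (q ^ 8)"
  define C where "C = (qpoch_inf q (q\<^sup>2))\<^sup>2"
  have p4: "norm (p ^ 4) < 1" "p ^ 4 \<noteq> 0"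
    using p by (auto intro: norm_power_less_1)
  \<comment> \<open>The dissection leads to the arguments -p^6 and -p^14 in base p^16, and
    reflection turns -p^14 into -p^2. These are -q^3 and -q in base q^8, whichever square root r is
    taken.\<close>
  have split: "theta_j r (p ^ 4) = J3 - r * J1" if r: "r\<^sup>2 = p\<^sup>2" for r
  proof -
    have "norm r = norm p"
      using r by (metis norm_minus_cancel power2_eq_iff)
    moreover have "norm (p ^ 4) < norm p"
      using p power_strict_decreasing[of 1 4 "norm p"] by (simp add: norm_power)
    moreover have "norm p < 1 / norm (p ^ 4)"
    proof -
      have "norm (p ^ Suc 4) < 1"
        using p by (intro norm_power_less_1) auto
      then have "norm p * norm (p ^ 4) < 1"
        by (simp only: power_Suc norm_mult)
      then show ?thesis
        using p by (simp add: pos_less_divide_eq)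
    qed
    ultimately have "theta_j r (p ^ 4) = theta_j (- (p ^ 4) * r\<^sup>2) ((p ^ 4) ^ 4)
        - r * theta_j (- ((p ^ 4) ^ 3) * r\<^sup>2) ((p ^ 4) ^ 4)"
      using theta_j_dissect[OF p4, of r] by simp
    also have "\<dots> = theta_j (- (p ^ 6)) (p ^ 16) - r * theta_j (- (p ^ 14)) (p ^ 16)"
      unfolding r by (simp flip: power_mult power_add)
    also have "theta_j (- (p ^ 14)) (p ^ 16) = theta_j (- (p\<^sup>2)) (p ^ 16)"
    proof -
      have "p ^ 16 / - (p ^ 14) = - (p\<^sup>2)"
        using p by (simp add: numeral_eq_Suc)
      then show ?thesis
        using theta_j_reflect[of "p ^ 16" "- (p ^ 14)"] p by simp
    qed
    finally show ?thesis
      unfolding J1_def J3_def pows by (simp add: q)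
  qed
  \<comment> \<open>Apart from the explicit r, the right-hand side depends only on q, so its even
    and odd parts in r can be read off.\<close>
  have phi: "mock_phi r = 2 * A1 + 2 / r * (1 - A3) - C * (J3 - r * J1)" if r: "r = p \<or> r = - p" for r
  proof -
    have r2: "r\<^sup>2 = p\<^sup>2" "r ^ 4 = p ^ 4" "r ^ 6 = p ^ 6" "r ^ 16 = p ^ 16"
      using r by auto
    have "norm r < 1" "r \<noteq> 0"
      using r p by auto
    from mock_phi_eq[OF this] show ?thesis
      unfolding r2 split[OF r2(1)] A1_def A3_def C_def pows by (simp add: q)
  qed
  have g: "2 - 2 * q * mock_g (- q) (q ^ 8) = 2 * A1"
    "2 * q\<^sup>2 * mock_g (- (q ^ 3)) (q ^ 8) = 2 / q * (1 - A3)"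
    using assms(1)
    by (simp_all add: mock_g_eq A1_def A3_def field_simps power2_eq_square power3_eq_cube)
  have Jb: "theta_J q 1 2 * theta_Jbar q 3 8 / theta_J1 q 2 = C * J3"
    "theta_J q 1 2 * theta_Jbar q 1 8 / theta_J1 q 2 = C * J1"
    using theta_J_quotient[OF assms(2,1)]
    by (simp_all add: C_def J1_def J3_def theta_Jbar_def times_divide_eq_left[symmetric] del: times_divide_eq_left)
  have "psibar0 q = 2 * A1 - C * J3"
    unfolding q psibar_eq_mock_phi(1)[OF p] phi[OF disjI1[OF refl]] phi[OF disjI2[OF refl]]
    using p by (simp add: field_simps)
  moreover have "psibar1 q = 2 / q * (1 - A3) + C * J1"
    unfolding q psibar_eq_mock_phi(2)[OF p] phi[OF disjI1[OF refl]] phi[OF disjI2[OF refl]]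
    using p by (simp add: field_simps power2_eq_square)
  ultimately show ?thesis
    unfolding g Jb by simp
qed

end
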